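(* Let $\{\mathcal{T}(t)\}_{t\ge 0}$ be the asymmetric telegraph process with velocities $c_1,-c_2$ ($c_1,c_2>0$) and rate $\lambda>0$, and let $t>0$. For every integer $k\ge 1$ and every $\beta\in[0,c_1t]$, $$P\Big\{\max_{0\le s\le t}\mathcal{T}(s)<\beta\ \Big|\ V(0)=c_1,\ N(t)=2k\Big\}=\frac{1}{[(c_1+c_2)t]^{2k}}\sum_{j=0}^{k-1}\binom{2k}{j}\Big[(c_1t-\beta)^{j}(c_2t+\beta)^{2k-j}-\Big(\frac{c_2}{c_1}\Big)^{2k-2j}(c_1t-\beta)^{2k-j}(c_2t+\beta)^{j}\Big].$$
   Context: Asymmetric telegraph process: let $c_1,c_2>0$, $\lambda>0$. Let $\{N(t)\}_{t\ge0}$ be a homogeneous Poisson process with rate $\lambda$, and let $V(0)$ be a random variable independent of $N$ with $P\{V(0)=c_1\}=P\{V(0)=-c_2\}=\frac12$. The velocity $V(s)$ takes values in $\{c_1,-c_2\}$, starts at $V(0)$, and switches from one of these two values to the other at each event of $N$, remaining constant between events. The position of the particle is $\mathcal{T}(t)=\int_0^t V(s)\,ds$ (so $\mathcal{T}(0)=0$). *)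

theory Defs
  imports "HOL-Probability.Probability"
begin

text \<open>Homogeneous Poisson process of rate \<open>lam\<close>: a counting process whose increments are
  independent and Poisson distributed. Path regularity is required of every sample path; that jumps
  almost surely have size one is a consequence and is not assumed.\<close>

locale poisson_process = prob_space M for M :: "'a measure" +
  fixes lam :: real and N :: "real \<Rightarrow> 'a \<Rightarrow> nat"
  assumes rate_pos: "lam > 0"
    and random_variable_N: "\<And>t. 0 \<le> t \<Longrightarrow> random_variable (count_space UNIV) (N t)"
    and N_0: "\<And>\<omega>. \<omega> \<in> space M \<Longrightarrow> N 0 \<omega> = 0"
    and mono_N: "\<And>\<omega>. \<omega> \<in> space M \<Longrightarrow> mono_on {0..} (\<lambda>t. N t \<omega>)"
    and right_continuous_N:
      "\<And>\<omega> t. \<omega> \<in> space M \<Longrightarrow> 0 \<le> t \<Longrightarrow> continuous (at_right t) (\<lambda>s. N s \<omega>)"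
    and poisson_increments:
      "\<And>s t. 0 \<le> s \<Longrightarrow> s < t \<Longrightarrow>
        distr M (count_space UNIV) (\<lambda>\<omega>. N t \<omega> - N s \<omega>) = measure_pmf (poisson_pmf (lam * (t - s)))"
    and independent_increments:
      "\<And>(n::nat) (\<tau> :: nat \<Rightarrow> real). 0 \<le> \<tau> 0 \<Longrightarrow> mono_on {..n} \<tau> \<Longrightarrow>
        indep_vars (\<lambda>_. count_space UNIV) (\<lambda>i \<omega>. N (\<tau> (Suc i)) \<omega> - N (\<tau> i) \<omega>) {..<n}"

text \<open>\<open>V0\<close> is the initial velocity. Its independence of the whole process \<open>(N t)\<^sub>t\<close> is stated
  through the generated sigma-algebras, because \<^const>\<open>prob_space.indep_var\<close> forces both variables
  to have the same type.\<close>

locale asymmetric_telegraph = poisson_process M lam N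
  for M :: "'a measure" and lam :: real and N :: "real \<Rightarrow> 'a \<Rightarrow> nat" +
  fixes c1 c2 :: real and V0 :: "'a \<Rightarrow> real"
  assumes c1_pos: "c1 > 0" and c2_pos: "c2 > 0"
    and random_variable_V0: "random_variable borel V0"
    and prob_V0_c1: "\<P>(\<omega> in M. V0 \<omega> = c1) = 1 / 2"
    and prob_V0_c2: "\<P>(\<omega> in M. V0 \<omega> = - c2) = 1 / 2"
    and indep_V0_N: "indep_set
      (sets (vimage_algebra (space M) V0 borel))
      (sets (vimage_algebra (space M) (\<lambda>\<omega>. \<lambda>t\<in>{0..}. N t \<omega>) (PiM {0..} (\<lambda>_. count_space UNIV))))"

definition switch_velocity :: "real \<Rightarrow> real \<Rightarrow> real \<Rightarrow> real" where
  "switch_velocity c1 c2 v = (if v = c1 then - c2 else c1)"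

definition telegraph_velocity ::
    "real \<Rightarrow> real \<Rightarrow> ('a \<Rightarrow> real) \<Rightarrow> (real \<Rightarrow> 'a \<Rightarrow> nat) \<Rightarrow> real \<Rightarrow> 'a \<Rightarrow> real" where
  "telegraph_velocity c1 c2 V0 N s \<omega> = (switch_velocity c1 c2 ^^ N s \<omega>) (V0 \<omega>)"

definition telegraph_position ::
    "real \<Rightarrow> real \<Rightarrow> ('a \<Rightarrow> real) \<Rightarrow> (real \<Rightarrow> 'a \<Rightarrow> nat) \<Rightarrow> real \<Rightarrow> 'a \<Rightarrow> real" where
  "telegraph_position c1 c2 V0 N t \<omega> = integral {0..t} (\<lambda>s. telegraph_velocity c1 c2 V0 N s \<omega>)"

end

theory Submission
  imports Defs
begin

text \<open>
  Given \<open>N t = n\<close>, the switching times are uniformly distributed on the simplex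
  \<open>0 < x\<^sub>1 < \<dots> < x\<^sub>n \<le> t\<close>, so the conditional probability is a quotient of two volumes: that of
  the switching sequences whose path stays below \<open>\<beta>\<close>, and that of the whole simplex,
  \<open>t ^ n / fact n\<close>.

  The first volume is found by peeling off the earliest switch. For a particle at level \<open>x\<close> at time
  \<open>s\<close>, put \<open>u = c1 * (t - s) - (\<beta> - x)\<close>, the overshoot of an uninterrupted ascent above \<open>\<beta>\<close>, and
  \<open>v = c2 * (t - s) + (\<beta> - x)\<close>, the final depth below \<open>\<beta>\<close> of an uninterrupted descent. While the
  particle rises, \<open>u\<close> is constant and \<open>v\<close> decreases at speed \<open>c1 + c2\<close>; while it falls, \<open>v\<close> is
  constant and \<open>u\<close> decreases at that speed. The volumes are therefore functions of \<open>u\<close> and \<open>v\<close>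
  alone. Let \<open>A\<^sub>m\<close> and \<open>B\<^sub>m\<close> be the volumes for a rising and a falling particle with \<open>m\<close> switches to
  come, in units in which \<open>c1 + c2 = 1\<close>. Then
  \<open>\<partial>\<^sub>v A\<^sub>m = B\<^sub>m\<^sub>-\<^sub>1\<close> and \<open>\<partial>\<^sub>u B\<^sub>m = A\<^sub>m\<^sub>-\<^sub>1\<close>. On \<open>x = \<beta>\<close>, that is \<open>v = (c2 / c1) * u\<close>, the volume \<open>A\<^sub>m\<close>
  vanishes, and for \<open>u = 0\<close> the level \<open>\<beta>\<close> is reached only on a
  null set, so that \<open>B\<^sub>m = v ^ m / fact m\<close>. A particle that starts upwards and
  switches an even number of times always has an even number of switches to come when it rises and an odd number when it falls, so only \<open>A\<^sub>2\<^sub>k\<close> and \<open>B\<^sub>2\<^sub>k\<^sub>+\<^sub>1\<close> matter. The sum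
  in the theorem is the solution \<open>up_poly\<close> for \<open>A\<^sub>2\<^sub>k\<close>, up to the factor \<open>fact (2 * k)\<close>; the partner
  for \<open>B\<^sub>2\<^sub>k\<^sub>+\<^sub>1\<close> is \<open>down_poly\<close>. This is \<open>volume_below_up_down\<close>.

  The uniform law (\<open>jump_times_law\<close>) comes from boxes
  \<open>(a\<^sub>1, b\<^sub>1] \<times> \<dots> \<times> (a\<^sub>n, b\<^sub>n]\<close> with \<open>b\<^sub>i \<le> a\<^sub>i\<^sub>+\<^sub>1\<close>: the jump times lie in such a box exactly if the
  counting process has increment one on each \<open>(a\<^sub>i, b\<^sub>i]\<close> and zero in between, which has probability
  \<open>lam ^ n * exp (- (lam * t)) * (b\<^sub>1 - a\<^sub>1) * \<dots> * (b\<^sub>n - a\<^sub>n)\<close>. These boxes are closed under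
  intersection and generate the Borel sets of the simplex. The simplex carries the full mass of
  \<open>N t = n\<close>, which shows in passing that simultaneous jumps have probability zero.

  Since the probability space need not be complete, discarding a null set of paths would not yield
  measurability of the event about the maximum. For this reason \<open>sup_position_below_iff\<close> expresses
  it through the jump times for every path, including paths with jumps larger than one. The same
  description puts the event into the sigma-algebra generated by \<open>N\<close>, so independence from \<open>V0\<close>
  applies.
\<close>

section \<open>Two families of polynomials\<close>

text \<open>\<open>up_poly \<rho> k u v\<close> is the solution of the recursion described above for a rising particle with \<open>2 * k\<close>
  switches to come, and \<open>down_poly \<rho> k u v\<close> that for a falling particle with \<open>2 * k + 1\<close> switches to
  come, both without their normalising factors; \<open>\<rho>\<close> is the ratio \<open>c2 / c1\<close>.\<close>

definition up_poly :: "real \<Rightarrow> nat \<Rightarrow> real \<Rightarrow> real \<Rightarrow> real" where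
  "up_poly \<rho> k u v = (\<Sum>j<k. real (2 * k choose j) *
     (u ^ j * v ^ (2 * k - j) - \<rho> ^ (2 * k - 2 * j) * u ^ (2 * k - j) * v ^ j))"

definition down_poly :: "real \<Rightarrow> nat \<Rightarrow> real \<Rightarrow> real \<Rightarrow> real" where
  "down_poly \<rho> k u v =
     (\<Sum>j\<le>k. real (Suc (2 * k) choose j) * (u ^ j * v ^ (Suc (2 * k) - j)))
   - (\<Sum>j<k. real (Suc (2 * k) choose j) * (\<rho> ^ (2 * k - 2 * j) * u ^ (Suc (2 * k) - j) * v ^ j))"

text \<open>On the line \<open>v = \<rho> * u\<close> the particle sits at the level itself. The two terms of each summand are
  \<open>(u * v) ^ j\<close> times the same power \<open>2 * (k - j)\<close> of \<open>v\<close> and of \<open>\<rho> * u\<close>.\<close>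

lemma up_poly_boundary: "up_poly \<rho> k u (\<rho> * u) = 0"
proof -
  have "u ^ j * (\<rho> * u) ^ (2 * k - j) = \<rho> ^ (2 * k - 2 * j) * u ^ (2 * k - j) * (\<rho> * u) ^ j"
    if "j < k" for j
  proof -
    define m where "m = 2 * k - 2 * j"
    have m: "2 * k - j = m + j" using that by (auto simp: m_def)
    show ?thesis unfolding m m_def[symmetric] power_add power_mult_distrib by simp
  qed
  then show ?thesis by (simp add: up_poly_def)
qed

lemma down_poly_0: "down_poly \<rho> k 0 v = v ^ Suc (2 * k)"
proof -
  have "(\<Sum>j\<le>k. real (Suc (2 * k) choose j) * (0 ^ j * v ^ (Suc (2 * k) - j)))
      = (\<Sum>j\<le>k. if j = 0 then v ^ Suc (2 * k) else 0)"
    by (intro sum.cong) auto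
  also have "\<dots> = v ^ Suc (2 * k)" by simp
  finally have 1: "(\<Sum>j\<le>k. real (Suc (2 * k) choose j) * (0 ^ j * v ^ (Suc (2 * k) - j))) = v ^ Suc (2 * k)" .
  have "(\<Sum>j<k. real (Suc (2 * k) choose j) * (\<rho> ^ (2 * k - 2 * j) * 0 ^ (Suc (2 * k) - j) * v ^ j)) = 0"
    by (intro sum.neutral) (auto simp: zero_power)
  then show ?thesis unfolding down_poly_def 1 by simp
qed

lemma binomial_mult_diff: "real (Suc n choose j) * real (Suc n - j) = real (Suc n) * real (n choose j)"
proof (cases "j \<le> n")
  case True
  have "Suc n * (n choose j) = (Suc n - j) * (Suc n choose j)"
    using True binomial_absorb_comp[of "Suc n" j] by simp
  then show ?thesis by (metis mult.commute of_nat_mult)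
qed (cases "j = Suc n"; simp add: not_le binomial_eq_0)

lemma binomial_mult_Suc: "real (Suc n choose Suc j) * real (Suc j) = real (Suc n) * real (n choose j)"
  by (metis Suc_times_binomial mult.commute of_nat_mult)

text \<open>Differentiating in \<open>v\<close> lowers the exponents of \<open>v\<close>. In the first terms \<open>j\<close> stays put; in the second
  terms the index \<open>j = 0\<close> disappears and the others move down by one, which is why \<open>down_poly\<close> has
  sums of different lengths.\<close>

lemma up_poly_deriv:
  "((\<lambda>v. up_poly \<rho> (Suc k) u v) has_real_derivative real (2 * k + 2) * down_poly \<rho> k u v) (at v)"
proof -
  let ?n = "Suc (2 * k)"
  have "((\<lambda>v. up_poly \<rho> (Suc k) u v) has_real_derivative
     (\<Sum>j<Suc k. real (2 * Suc k choose j) * (u ^ j * (real (2 * Suc k - j) * v ^ (2 * Suc k - j - 1))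
       - \<rho> ^ (2 * Suc k - 2 * j) * u ^ (2 * Suc k - j) * (real j * v ^ (j - 1))))) (at v)"
    unfolding up_poly_def
    by (intro DERIV_sum) (auto intro!: derivative_eq_intros)
  also have "(\<Sum>j<Suc k. real (2 * Suc k choose j) * (u ^ j * (real (2 * Suc k - j) * v ^ (2 * Suc k - j - 1))
       - \<rho> ^ (2 * Suc k - 2 * j) * u ^ (2 * Suc k - j) * (real j * v ^ (j - 1))))
     = (\<Sum>j<Suc k. real (Suc ?n) * (real (?n choose j) * (u ^ j * v ^ (?n - j))))
      - (\<Sum>j<Suc k. real (Suc ?n choose j) * real j *
           (\<rho> ^ (2 * Suc k - 2 * j) * u ^ (2 * Suc k - j) * v ^ (j - 1)))"
    unfolding sum_subtractf[symmetric]
  proof (intro sum.cong refl)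
    fix j assume "j \<in> {..<Suc k}"
    have a: "2 * Suc k = Suc ?n" by simp
    have b: "Suc ?n - j - 1 = ?n - j" by simp
    have "real (Suc ?n choose j) * (u ^ j * (real (Suc ?n - j) * v ^ (?n - j)))
       = (real (Suc ?n choose j) * real (Suc ?n - j)) * (u ^ j * v ^ (?n - j))"
      by simp
    also have "\<dots> = real (Suc ?n) * (real (?n choose j) * (u ^ j * v ^ (?n - j)))"
      unfolding binomial_mult_diff by simp
    finally show "real (2 * Suc k choose j) * (u ^ j * (real (2 * Suc k - j) * v ^ (2 * Suc k - j - 1))
       - \<rho> ^ (2 * Suc k - 2 * j) * u ^ (2 * Suc k - j) * (real j * v ^ (j - 1)))
      = real (Suc ?n) * (real (?n choose j) * (u ^ j * v ^ (?n - j)))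
      - real (Suc ?n choose j) * real j *
           (\<rho> ^ (2 * Suc k - 2 * j) * u ^ (2 * Suc k - j) * v ^ (j - 1))"
      unfolding a b by (simp add: right_diff_distrib)
  qed
  also have "(\<Sum>j<Suc k. real (Suc ?n choose j) * real j *
           (\<rho> ^ (2 * Suc k - 2 * j) * u ^ (2 * Suc k - j) * v ^ (j - 1)))
     = (\<Sum>j<k. real (Suc ?n choose Suc j) * real (Suc j) *
           (\<rho> ^ (2 * k - 2 * j) * u ^ (?n - j) * v ^ j))"
    by (subst sum.lessThan_Suc_shift) simp
  also have "\<dots> = (\<Sum>j<k. real (Suc ?n) * (real (?n choose j) * (\<rho> ^ (2 * k - 2 * j) * u ^ (?n - j) * v ^ j)))"
    unfolding binomial_mult_Suc by (simp add: mult.assoc)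
  finally show ?thesis
    unfolding down_poly_def lessThan_Suc_atMost sum_distrib_left[symmetric]
    by (simp add: right_diff_distrib)
qed

text \<open>The same absorption identities, now with the shift in the first sum; this makes both sums run
  over \<open>j < k\<close> again.\<close>

lemma down_poly_deriv:
  "((\<lambda>u. down_poly \<rho> k u v) has_real_derivative real (2 * k + 1) * up_poly \<rho> k u v) (at u)"
proof -
  let ?n = "2 * k"
  have "((\<lambda>u. down_poly \<rho> k u v) has_real_derivative
     (\<Sum>j\<le>k. real (Suc ?n choose j) * (real j * u ^ (j - 1) * v ^ (Suc ?n - j)))
   - (\<Sum>j<k. real (Suc ?n choose j) *
       (\<rho> ^ (2 * k - 2 * j) * (real (Suc ?n - j) * u ^ (Suc ?n - j - 1)) * v ^ j))) (at u)"
    unfolding down_poly_def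
    by (intro DERIV_sum DERIV_diff) (auto intro!: derivative_eq_intros)
  also have "(\<Sum>j\<le>k. real (Suc ?n choose j) * (real j * u ^ (j - 1) * v ^ (Suc ?n - j)))
     = (\<Sum>j<k. real (Suc ?n choose Suc j) * real (Suc j) * (u ^ j * v ^ (?n - j)))"
    unfolding lessThan_Suc_atMost[symmetric] 
    by (subst sum.lessThan_Suc_shift) (simp add: mult.assoc)
  also have "\<dots> = (\<Sum>j<k. real (Suc ?n) * (real (?n choose j) * (u ^ j * v ^ (?n - j))))"
    unfolding binomial_mult_Suc by (simp add: mult.assoc)
  also have "(\<Sum>j<k. real (Suc ?n choose j) *
       (\<rho> ^ (2 * k - 2 * j) * (real (Suc ?n - j) * u ^ (Suc ?n - j - 1)) * v ^ j))
     = (\<Sum>j<k. real (Suc ?n) * (real (?n choose j) * (\<rho> ^ (2 * k - 2 * j) * u ^ (?n - j) * v ^ j)))"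
  proof (intro sum.cong refl)
    fix j
    have "real (Suc ?n choose j) * (\<rho> ^ (2 * k - 2 * j) * (real (Suc ?n - j) * u ^ (Suc ?n - j - 1)) * v ^ j)
       = (real (Suc ?n choose j) * real (Suc ?n - j)) * (\<rho> ^ (2 * k - 2 * j) * u ^ (?n - j) * v ^ j)"
      by simp
    then show "real (Suc ?n choose j) * (\<rho> ^ (2 * k - 2 * j) * (real (Suc ?n - j) * u ^ (Suc ?n - j - 1)) * v ^ j)
       = real (Suc ?n) * (real (?n choose j) * (\<rho> ^ (2 * k - 2 * j) * u ^ (?n - j) * v ^ j))"
      unfolding binomial_mult_diff by simp
  qed
  finally show ?thesis
    by (simp only: up_poly_def right_diff_distrib sum_subtractf sum_distrib_left[symmetric]
         Suc_eq_plus1)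
qed

lemma up_poly_nonneg:
  assumes "0 \<le> u" "0 \<le> \<rho>" "\<rho> * u \<le> v"
  shows "0 \<le> up_poly \<rho> k u v"
  unfolding up_poly_def
proof (intro sum_nonneg mult_nonneg_nonneg)
  fix j assume j: "j \<in> {..<k}"
  have "0 \<le> \<rho> * u" using assms by simp
  then have v: "0 \<le> v" using assms(3) by linarith
  define m where "m = 2 * k - 2 * j"
  have m: "2 * k - j = m + j" using j by (auto simp: m_def)
  have "u ^ j * v ^ (2 * k - j) - \<rho> ^ (2 * k - 2 * j) * u ^ (2 * k - j) * v ^ j
     = (u * v) ^ j * (v ^ m - (\<rho> * u) ^ m)"
    unfolding m m_def[symmetric] power_add power_mult_distrib by (simp add: right_diff_distrib)
  also have "\<dots> \<ge> 0"
  proof -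
    have "(\<rho> * u) ^ m \<le> v ^ m" using assms(3) \<open>0 \<le> \<rho> * u\<close> by (rule power_mono)
    then show ?thesis using assms(1) v by simp
  qed
  finally show "0 \<le> u ^ j * v ^ (2 * k - j) - \<rho> ^ (2 * k - 2 * j) * u ^ (2 * k - j) * v ^ j" .
qed simp

text \<open>The individual terms can be negative when \<open>v < u\<close>. The polynomial is nonnegative at \<open>u = 0\<close>, and its
  derivative in \<open>u\<close> is nonnegative on the whole segment from \<open>0\<close> to \<open>u\<close>, because \<open>\<rho> * z \<le> v\<close> holds for
  smaller \<open>z\<close> as well.\<close>

lemma down_poly_nonneg:
  assumes "0 \<le> u" "0 \<le> \<rho>" "\<rho> * u \<le> v"
  shows "0 \<le> down_poly \<rho> k u v"
proof -
  have "0 \<le> \<rho> * u" using assms by simp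
  then have "0 \<le> v" using assms(3) by linarith
  then have "0 \<le> down_poly \<rho> k 0 v" by (simp add: down_poly_0)
  also have "down_poly \<rho> k 0 v \<le> down_poly \<rho> k u v"
  proof (rule DERIV_nonneg_imp_nondecreasing[OF assms(1)])
    fix z assume z: "0 \<le> z" "z \<le> u"
    have "\<rho> * z \<le> v" using mult_left_mono[OF z(2) assms(2)] assms(3) by linarith
    then have "0 \<le> up_poly \<rho> k z v" using z assms by (intro up_poly_nonneg) auto
    then show "\<exists>y. ((\<lambda>u. down_poly \<rho> k u v) has_real_derivative y) (at z) \<and> 0 \<le> y"
      using down_poly_deriv[of \<rho> k v z]
        mult_nonneg_nonneg[OF of_nat_0_le_iff[of "2 * k + 1"] \<open>0 \<le> up_poly \<rho> k z v\<close>] by blast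
  qed
  finally show ?thesis .
qed

section \<open>Volume of the switching sequences that keep the path below a level\<close>

text \<open>A particle at level \<open>x\<close> at time \<open>s\<close> moves with velocity \<open>v\<close>, alternating with \<open>w\<close> at the times in the
  list, until time \<open>t\<close>. The path is piecewise affine, so it stays below \<open>\<beta>\<close> as soon as all its vertices
  do. The order of the times is not part of this predicate: it is kept apart in \<open>increasing_upto\<close>,
  because the jump times of a path with larger jumps are only weakly increasing.\<close>

fun below :: "real \<Rightarrow> real \<Rightarrow> real \<Rightarrow> real \<Rightarrow> real \<Rightarrow> real \<Rightarrow> real list \<Rightarrow> bool" where
  "below t \<beta> v w x s [] \<longleftrightarrow> x < \<beta> \<and> x + v * (t - s) < \<beta>"
| "below t \<beta> v w x s (y # ys) \<longleftrightarrow> x < \<beta> \<and> below t \<beta> w v (x + v * (y - s)) y ys"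

fun increasing_upto :: "real \<Rightarrow> real \<Rightarrow> real list \<Rightarrow> bool" where
  "increasing_upto t s [] \<longleftrightarrow> s \<le> t"
| "increasing_upto t s (y # ys) \<longleftrightarrow> s < y \<and> increasing_upto t y ys"

lemma increasing_upto_le: "increasing_upto t s ys \<Longrightarrow> s \<le> t"
  by (induction ys arbitrary: s) force+

text \<open>Starting level and starting time have to be random for the induction to go through, since both
  depend on the earlier switching times.\<close>

lemma measurable_below:
  assumes "X \<in> borel_measurable M" "S \<in> borel_measurable M"
    and "\<And>i. i \<in> set is \<Longrightarrow> g i \<in> borel_measurable M"
  shows "Measurable.pred M (\<lambda>\<omega>. below t \<beta> v w (X \<omega>) (S \<omega>) (map (\<lambda>i. g i \<omega>) is))"
  using assms
proof (induction "is" arbitrary: X S v w)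
  case Nil
  note [measurable] = Nil(1,2)
  show ?case by simp
next
  case (Cons i "is")
  note [measurable] = Cons(2,3) Cons.prems(3)[of i, simplified]
  have [measurable]: "Measurable.pred M
      (\<lambda>\<omega>. below t \<beta> w v (X \<omega> + v * (g i \<omega> - S \<omega>)) (g i \<omega>) (map (\<lambda>i. g i \<omega>) is))"
    using Cons.prems by (intro Cons.IH) auto
  show ?case by simp
qed

lemma measurable_increasing_upto:
  assumes "S \<in> borel_measurable M"
    and "\<And>i. i \<in> set is \<Longrightarrow> g i \<in> borel_measurable M"
  shows "Measurable.pred M (\<lambda>\<omega>. increasing_upto t (S \<omega>) (map (\<lambda>i. g i \<omega>) is))"
  using assms
proof (induction "is" arbitrary: S)
  case Nil
  note [measurable] = Nil(1)
  show ?case by simp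
next
  case (Cons i "is")
  note [measurable] = Cons(2) Cons.prems(2)[of i, simplified]
  have [measurable]: "Measurable.pred M
      (\<lambda>\<omega>. increasing_upto t (g i \<omega>) (map (\<lambda>i. g i \<omega>) is))"
    using Cons.prems by (intro Cons.IH) auto
  show ?case by simp
qed

text \<open>The coordinates are indexed by \<open>{i..<n}\<close> so that removing the earliest switch leads to the same
  kind of set with \<open>i\<close> replaced by \<open>Suc i\<close>.\<close>

definition switch_times_below ::
    "real \<Rightarrow> real \<Rightarrow> real \<Rightarrow> real \<Rightarrow> real \<Rightarrow> real \<Rightarrow> nat \<Rightarrow> nat \<Rightarrow> (nat \<Rightarrow> real) set" where
  "switch_times_below t \<beta> v w x s i n = {f \<in> space (PiM {i..<n} (\<lambda>_. lborel)).
     increasing_upto t s (map f [i..<n]) \<and> below t \<beta> v w x s (map f [i..<n])}"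

definition volume_below ::
    "real \<Rightarrow> real \<Rightarrow> real \<Rightarrow> real \<Rightarrow> real \<Rightarrow> real \<Rightarrow> nat \<Rightarrow> nat \<Rightarrow> ennreal" where
  "volume_below t \<beta> v w x s i n =
     emeasure (PiM {i..<n} (\<lambda>_. lborel)) (switch_times_below t \<beta> v w x s i n)"

lemma sets_switch_times_below [measurable]:
  "switch_times_below t \<beta> v w x s i n \<in> sets (PiM {i..<n} (\<lambda>_. lborel))"
proof -
  have "Measurable.pred (PiM {i..<n} (\<lambda>_. lborel)) (\<lambda>f. increasing_upto t s (map (\<lambda>j. f j) [i..<n]))"
    by (intro measurable_increasing_upto) auto
  moreover have "Measurable.pred (PiM {i..<n} (\<lambda>_. lborel)) (\<lambda>f. below t \<beta> v w x s (map (\<lambda>j. f j) [i..<n]))"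
    by (intro measurable_below) auto
  ultimately show ?thesis unfolding switch_times_below_def by measurable
qed

lemma volume_below_Nil:
  "volume_below t \<beta> v w x s n n = (if s \<le> t \<and> x < \<beta> \<and> x + v * (t - s) < \<beta> then 1 else 0)"
proof -
  have "switch_times_below t \<beta> v w x s n n
      = (if s \<le> t \<and> x < \<beta> \<and> x + v * (t - s) < \<beta> then {\<lambda>_. undefined} else {})"
    by (auto simp: switch_times_below_def space_PiM)
  then show ?thesis by (simp add: volume_below_def PiM_empty)
qed

lemma volume_below_above: "\<beta> \<le> x \<Longrightarrow> volume_below t \<beta> v w x s i n = 0"
proof -
  assume "\<beta> \<le> x"
  then have "\<not> below t \<beta> v w x s ys" for ys by (cases ys) auto
  then show ?thesis by (simp add: volume_below_def switch_times_below_def)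
qed

text \<open>Fubini in the coordinate of the earliest switch \<open>y\<close>: after it, the velocities exchange their roles.\<close>

lemma volume_below_step:
  assumes "i < n" "x < \<beta>"
  shows "volume_below t \<beta> v w x s i n =
    (\<integral>\<^sup>+ y. indicator {s<..t} y * volume_below t \<beta> w v (x + v * (y - s)) y (Suc i) n \<partial>lborel)"
proof -
  interpret product_sigma_finite "\<lambda>_::nat. lborel :: real measure" ..
  let ?I = "{Suc i..<n}"
  let ?S = "switch_times_below t \<beta> v w x s i n"
  let ?T = "\<lambda>y. switch_times_below t \<beta> w v (x + v * (y - s)) y (Suc i) n"
  have ins: "{i..<n} = insert i ?I" using assms by auto
  have upt: "[i..<n] = i # [Suc i..<n]" using assms by (simp add: upt_conv_Cons)
  have "volume_below t \<beta> v w x s i n = (\<integral>\<^sup>+ f. indicator ?S f \<partial>PiM (insert i ?I) (\<lambda>_. lborel))"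
    unfolding volume_below_def ins[symmetric] by (subst nn_integral_indicator) auto
  also have "\<dots> = (\<integral>\<^sup>+ y. \<integral>\<^sup>+ f. indicator ?S (f(i := y)) \<partial>PiM ?I (\<lambda>_. lborel) \<partial>lborel)"
    by (intro product_nn_integral_insert_rev) (auto simp: ins[symmetric])
  also have "\<dots> = (\<integral>\<^sup>+ y. indicator {s<..t} y * volume_below t \<beta> w v (x + v * (y - s)) y (Suc i) n \<partial>lborel)"
  proof (intro nn_integral_cong)
    fix y :: real
    have "indicator ?S (f(i := y)) = (indicator {s<..t} y * indicator (?T y) f :: ennreal)"
      if f: "f \<in> space (PiM ?I (\<lambda>_. lborel))" for f
    proof -
      have "f(i := y) \<in> space (PiM {i..<n} (\<lambda>_. lborel))"
        using f assms unfolding ins by (auto simp: space_PiM PiE_def extensional_def)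
      moreover have "map (f(i := y)) [Suc i..<n] = map f [Suc i..<n]" by simp
      ultimately have "f(i := y) \<in> ?S \<longleftrightarrow> s < y \<and> f \<in> ?T y"
        using f assms(2) unfolding switch_times_below_def upt by simp
      moreover have "y \<le> t" if "f \<in> ?T y"
        using that by (auto simp: switch_times_below_def dest: increasing_upto_le)
      ultimately show ?thesis by (auto simp: indicator_def)
    qed
    then have "(\<integral>\<^sup>+ f. indicator ?S (f(i := y)) \<partial>PiM ?I (\<lambda>_. lborel))
        = (\<integral>\<^sup>+ f. indicator {s<..t} y * indicator (?T y) f \<partial>PiM ?I (\<lambda>_. lborel))"
      by (intro nn_integral_cong)
    also have "\<dots> = indicator {s<..t} y * volume_below t \<beta> w v (x + v * (y - s)) y (Suc i) n"
      unfolding volume_below_def by (subst nn_integral_cmult) auto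
    finally show "(\<integral>\<^sup>+ f. indicator ?S (f(i := y)) \<partial>PiM ?I (\<lambda>_. lborel))
        = indicator {s<..t} y * volume_below t \<beta> w v (x + v * (y - s)) y (Suc i) n" .
  qed
  finally show ?thesis .
qed

text \<open>The volume after the first switch is given by different formulas according to whether the level
  is within reach or not, so the integral splits at one point \<open>m\<close>. At \<open>m\<close> and
  at the end points the two formulas may be wrong, but these form a null set.\<close>

lemma nn_integral_two_primitives:
  fixes F1 F2 f1 f2 :: "real \<Rightarrow> real"
  assumes "a \<le> m" "m \<le> b"
    and cont: "continuous_on UNIV f1" "continuous_on UNIV f2"
    and g: "\<And>y. a < y \<Longrightarrow> y < m \<Longrightarrow> g y = ennreal (f1 y)"
      "\<And>y. m < y \<Longrightarrow> y < b \<Longrightarrow> g y = ennreal (f2 y)"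
    and F: "\<And>y. (F1 has_real_derivative f1 y) (at y)" "\<And>y. (F2 has_real_derivative f2 y) (at y)"
    and pos: "\<And>y. a \<le> y \<Longrightarrow> y \<le> m \<Longrightarrow> 0 \<le> f1 y" "\<And>y. m \<le> y \<Longrightarrow> y \<le> b \<Longrightarrow> 0 \<le> f2 y"
  shows "(\<integral>\<^sup>+ y. indicator {a<..b} y * g y \<partial>lborel) = ennreal ((F1 m - F1 a) + (F2 b - F2 m))"
proof -
  have [measurable]: "f1 \<in> borel_measurable borel" "f2 \<in> borel_measurable borel"
    using cont by (auto intro: borel_measurable_continuous_onI)
  have "AE y in lborel. y \<noteq> a \<and> y \<noteq> m \<and> y \<noteq> b"
    using AE_lborel_singleton[of a] AE_lborel_singleton[of m] AE_lborel_singleton[of b]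
    by eventually_elim auto
  then have "AE y in lborel. indicator {a<..b} y * g y
      = ennreal (f1 y) * indicator {a..m} y + ennreal (f2 y) * indicator {m..b} y"
  proof eventually_elim
    case (elim y)
    then show ?case
      using assms(1,2) by (cases y m rule: linorder_cases) (auto simp: indicator_def g)
  qed
  then have "(\<integral>\<^sup>+ y. indicator {a<..b} y * g y \<partial>lborel)
      = (\<integral>\<^sup>+ y. ennreal (f1 y) * indicator {a..m} y + ennreal (f2 y) * indicator {m..b} y \<partial>lborel)"
    by (rule nn_integral_cong_AE)
  also have "\<dots> = (\<integral>\<^sup>+ y. ennreal (f1 y) * indicator {a..m} y \<partial>lborel)
      + (\<integral>\<^sup>+ y. ennreal (f2 y) * indicator {m..b} y \<partial>lborel)"
    by (intro nn_integral_add) auto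
  also have "(\<integral>\<^sup>+ y. ennreal (f1 y) * indicator {a..m} y \<partial>lborel) = ennreal (F1 m - F1 a)"
    using F pos assms(1) by (intro nn_integral_FTC_Icc) auto
  also have "(\<integral>\<^sup>+ y. ennreal (f2 y) * indicator {m..b} y \<partial>lborel) = ennreal (F2 b - F2 m)"
    using F pos assms(2) by (intro nn_integral_FTC_Icc) auto
  also have "ennreal (F1 m - F1 a) + ennreal (F2 b - F2 m) = ennreal ((F1 m - F1 a) + (F2 b - F2 m))"
  proof (rule ennreal_plus[symmetric])
    have "F1 a \<le> F1 m"
      using F(1) pos(1) by (intro DERIV_nonneg_imp_nondecreasing[OF assms(1)]) blast
    then show "0 \<le> F1 m - F1 a" by simp
    have "F2 m \<le> F2 b"
      using F(2) pos(2) by (intro DERIV_nonneg_imp_nondecreasing[OF assms(2)]) blast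
    then show "0 \<le> F2 b - F2 m" by simp
  qed
  finally show ?thesis .
qed

lemma simplex_volume_deriv:
  "((\<lambda>y. - ((t - y) ^ Suc m / fact (Suc m))) has_real_derivative (t - y) ^ m / fact m) (at y)"
  for t y :: real
proof -
  have "((\<lambda>y. (t - y) ^ Suc m) has_real_derivative - (real (Suc m) * (t - y) ^ m)) (at y)"
    by (auto intro!: derivative_eq_intros simp del: power_Suc)
  from DERIV_cdivide[OF this, of "- fact (Suc m)"] show ?thesis
    by (simp del: power_Suc of_nat_Suc add: fact_Suc)
qed

text \<open>If not even a particle of upward speed \<open>c\<close> reaches the level by time \<open>t\<close>, then the condition on
  the path is void and the volume is that of a simplex.\<close>

lemma volume_below_free:
  assumes "s \<le> t" "0 \<le> c" "v \<le> c" "w \<le> c" "x + c * (t - s) < \<beta>" "i \<le> n"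
  shows "volume_below t \<beta> v w x s i n = ennreal ((t - s) ^ (n - i) / fact (n - i))"
  using assms
proof (induction "n - i" arbitrary: i v w x s)
  case 0
  have "v * (t - s) \<le> c * (t - s)" "0 \<le> c * (t - s)" using 0 by (auto intro: mult_right_mono)
  then have "x < \<beta>" "x + v * (t - s) < \<beta>" using 0(6) by linarith+
  with 0 show ?case by (simp add: volume_below_Nil)
next
  case (Suc m)
  have "0 \<le> c * (t - s)" using Suc.prems by simp
  then have x: "x < \<beta>" using Suc.prems by linarith
  have m: "m = n - Suc i" "n - i = Suc m" "Suc i \<le> n" using Suc.hyps(2) by auto
  have "volume_below t \<beta> v w x s i n =
    (\<integral>\<^sup>+ y. indicator {s<..t} y * volume_below t \<beta> w v (x + v * (y - s)) y (Suc i) n \<partial>lborel)"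
    using m x by (intro volume_below_step) auto
  also have "\<dots> = ennreal ((- ((t - t) ^ Suc m / fact (Suc m)) - (- ((t - s) ^ Suc m / fact (Suc m)))) + (0 - 0))"
  proof (rule nn_integral_two_primitives[OF _ _ _ _ _ _ simplex_volume_deriv DERIV_const])
    fix y assume y: "s < y" "y < t"
    have "v * (y - s) \<le> c * (y - s)" using Suc.prems y by (intro mult_right_mono) auto
    then have "x + v * (y - s) + c * (t - y) < \<beta>" using Suc.prems(5) by (simp add: algebra_simps)
    then show "volume_below t \<beta> w v (x + v * (y - s)) y (Suc i) n = ennreal ((t - y) ^ m / fact m)"
      using Suc.hyps(1)[of "Suc i" y w v "x + v * (y - s)"] m Suc.prems y by simp
  qed (use Suc.prems in \<open>auto intro!: continuous_intros\<close>)
  finally show ?case using m by simp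
qed

text \<open>The recursion in \<open>u\<close> and \<open>v\<close>, with the factors \<open>c = c1 + c2\<close> that come from integrating over the time
  \<open>y\<close> instead of over \<open>u\<close> or \<open>v\<close>. A falling particle may enter the region \<open>u < 0\<close>, from which the level
  is out of reach; a rising particle must switch before it hits the level, where the volume
  vanishes.\<close>

lemma volume_below_up_down:
  fixes c1 c2 t \<beta> :: real
  assumes c: "0 < c1" "0 < c2"
  defines "c \<equiv> c1 + c2" and "\<rho> \<equiv> c2 / c1"
    and "U \<equiv> \<lambda>x s. c1 * (t - s) - (\<beta> - x)" and "V \<equiv> \<lambda>x s. c2 * (t - s) + (\<beta> - x)"
  shows "\<And>i n x s. \<lbrakk>n = i + 2 * k; s \<le> t; x \<le> \<beta>; 0 \<le> U x s\<rbrakk> \<Longrightarrow>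
      volume_below t \<beta> c1 (- c2) x s i n
        = ennreal (up_poly \<rho> k (U x s) (V x s) / (fact (2 * k) * c ^ (2 * k)))" (is "PROP ?A k")
    and "\<And>i n x s. \<lbrakk>n = i + Suc (2 * k); s \<le> t; x < \<beta>; 0 \<le> U x s\<rbrakk> \<Longrightarrow>
      volume_below t \<beta> (- c2) c1 x s i n
        = ennreal (down_poly \<rho> k (U x s) (V x s) / (fact (Suc (2 * k)) * c ^ Suc (2 * k)))" (is "PROP ?B k")
proof -
  have cpos: "0 < c" "0 \<le> \<rho>" using c by (auto simp: c_def \<rho>_def)
  have rho: "V x s - \<rho> * U x s = c * (\<beta> - x) / c1" for x s
    using c by (simp add: V_def U_def \<rho>_def c_def field_simps)
  have ord: "\<rho> * U x s \<le> V x s" if "x \<le> \<beta>" for x s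
  proof -
    have "0 \<le> c * (\<beta> - x) / c1" using c that cpos by simp
    then show ?thesis using rho[of x s] by linarith
  qed
  have down_of_up: "PROP ?B k" if A: "PROP ?A k" for k
  proof -
    fix i n x s
    assume n: "n = i + Suc (2 * k)" and s: "s \<le> t" and x: "x < \<beta>" and u: "0 \<le> U x s"
    let ?u = "U x s" and ?v = "V x s"
    let ?K = "fact (2 * k) * c ^ (2 * k)"
    \<comment> \<open>The time at which the falling particle has \<open>u = 0\<close>.\<close>
    define z where "z = s + ?u / c"
    have uv: "?u + ?v = c * (t - s)" by (simp add: U_def V_def c_def algebra_simps)
    have tz: "t - z = ?v / c" using uv cpos by (simp add: z_def field_simps)
    have v: "0 < ?v" using c s x unfolding V_def by (intro add_nonneg_pos mult_nonneg_nonneg) auto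
    have z: "s \<le> z" "z \<le> t"
      using u cpos v tz by (simp_all add: z_def) (smt (verit) divide_pos_pos)
    have U': "U (x + - c2 * (y - s)) y = ?u - c * (y - s)" and V': "V (x + - c2 * (y - s)) y = ?v" for y
      by (simp_all add: U_def V_def c_def algebra_simps)
    let ?g = "\<lambda>y. volume_below t \<beta> c1 (- c2) (x + - c2 * (y - s)) y (Suc i) n"
    have "volume_below t \<beta> (- c2) c1 x s i n = (\<integral>\<^sup>+ y. indicator {s<..t} y * ?g y \<partial>lborel)"
      using n x by (intro volume_below_step) auto
    also have "\<dots> = ennreal (
       (- (down_poly \<rho> k (?u - c * (z - s)) ?v / (fact (Suc (2 * k)) * c ^ Suc (2 * k)))
      - - (down_poly \<rho> k (?u - c * (s - s)) ?v / (fact (Suc (2 * k)) * c ^ Suc (2 * k))))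
      + (- ((t - t) ^ Suc (2 * k) / fact (Suc (2 * k))) - - ((t - z) ^ Suc (2 * k) / fact (Suc (2 * k)))))"
    proof (rule nn_integral_two_primitives[OF z _ _ _ _ _ simplex_volume_deriv])
      have chain: "((\<lambda>y. down_poly \<rho> k (?u - c * (y - s)) ?v) has_real_derivative
          real (2 * k + 1) * up_poly \<rho> k (?u - c * (y - s)) ?v * - c) (at y)" for y
        by (rule DERIV_chain2[OF down_poly_deriv]) (auto intro!: derivative_eq_intros)
      show "((\<lambda>y. - (down_poly \<rho> k (?u - c * (y - s)) ?v / (fact (Suc (2 * k)) * c ^ Suc (2 * k))))
          has_real_derivative up_poly \<rho> k (?u - c * (y - s)) ?v / ?K) (at y)" for y
        using DERIV_cdivide[OF chain, of "- (fact (Suc (2 * k)) * c ^ Suc (2 * k))" y] cpos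
        by (simp del: of_nat_Suc add: fact_Suc)
      show "continuous_on UNIV (\<lambda>y. up_poly \<rho> k (?u - c * (y - s)) ?v / ?K)"
        unfolding up_poly_def using cpos by (auto intro!: continuous_intros)
      show "continuous_on UNIV (\<lambda>y. (t - y) ^ (2 * k) / fact (2 * k))"
        by (auto intro!: continuous_intros)
      show "0 \<le> (t - y) ^ (2 * k) / fact (2 * k)" if "y \<le> t" for y
        using that by simp
      have u': "0 \<le> ?u - c * (y - s)" if "y \<le> z" for y
        using that cpos by (simp add: z_def field_simps)
      have x': "x + - c2 * (y - s) \<le> \<beta>" if "s \<le> y" for y
      proof -
        have "0 \<le> c2 * (y - s)" using c that by simp
        then show ?thesis using x by simp
      qed
      show "0 \<le> up_poly \<rho> k (?u - c * (y - s)) ?v / ?K" if "s \<le> y" "y \<le> z" for y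
      proof -
        have "0 \<le> up_poly \<rho> k (?u - c * (y - s)) ?v"
          using ord[OF x'[OF that(1)], of y] u'[OF that(2)] cpos unfolding U' V'
          by (intro up_poly_nonneg) auto
        then show ?thesis using cpos by simp
      qed
      show "?g y = ennreal (up_poly \<rho> k (?u - c * (y - s)) ?v / ?K)" if "s < y" "y < z" for y
        using A[of n "Suc i" y "x + - c2 * (y - s)"] n z that x'[of y] u'[of y] unfolding U' V' by simp
      show "?g y = ennreal ((t - y) ^ (2 * k) / fact (2 * k))" if "z < y" "y < t" for y
      proof -
        have "?u < c * (y - s)" using that(1) cpos by (simp add: z_def field_simps)
        then have "U (x + - c2 * (y - s)) y < 0" unfolding U' by simp
        then have "volume_below t \<beta> c1 (- c2) (x + - c2 * (y - s)) y (Suc i) n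
            = ennreal ((t - y) ^ (n - Suc i) / fact (n - Suc i))"
          using that c n by (intro volume_below_free[where c = c1]) (auto simp: U_def)
        then show ?thesis using n by simp
      qed
    qed
    also have "?u - c * (z - s) = 0" using cpos by (simp add: z_def)
    finally show "volume_below t \<beta> (- c2) c1 x s i n
        = ennreal (down_poly \<rho> k ?u ?v / (fact (Suc (2 * k)) * c ^ Suc (2 * k)))"
      unfolding tz down_poly_0 by (simp add: power_divide del: power_Suc)
  qed
  show A: "PROP ?A k"
  proof (induction k)
    case 0
    then show ?case by (simp add: up_poly_def volume_below_Nil U_def not_less)
  next
    case (Suc k)
    note B = down_of_up[OF Suc.IH]
    let ?u = "U x s" and ?v = "V x s"
    let ?K = "fact (Suc (2 * k)) * c ^ Suc (2 * k)"
    let ?L = "fact (2 * Suc k) * c ^ (2 * Suc k)"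
    show ?case
    proof (cases "x = \<beta>")
      case True
      then have "?v = \<rho> * ?u" using c by (simp add: U_def V_def \<rho>_def)
      then show ?thesis using True by (simp add: volume_below_above up_poly_boundary)
    next
      case False
      then have x: "x < \<beta>" using Suc.prems by simp
      \<comment> \<open>The time at which the rising particle hits the level.\<close>
      define z where "z = s + (\<beta> - x) / c1"
      have z: "s \<le> z" "z \<le> t"
        using x c Suc.prems by (simp_all add: z_def U_def field_simps)
      have U': "U (x + c1 * (y - s)) y = ?u" and V': "V (x + c1 * (y - s)) y = ?v - c * (y - s)" for y
        by (simp_all add: U_def V_def c_def algebra_simps)
      have x': "x + c1 * (y - s) < \<beta> \<longleftrightarrow> y < z" for y
        using c by (simp add: z_def field_simps)
      let ?g = "\<lambda>y. volume_below t \<beta> (- c2) c1 (x + c1 * (y - s)) y (Suc i) n"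
      have "volume_below t \<beta> c1 (- c2) x s i n = (\<integral>\<^sup>+ y. indicator {s<..t} y * ?g y \<partial>lborel)"
        using Suc.prems x by (intro volume_below_step) auto
      also have "\<dots> = ennreal (
         (- (up_poly \<rho> (Suc k) ?u (?v - c * (z - s)) / ?L)
        - - (up_poly \<rho> (Suc k) ?u (?v - c * (s - s)) / ?L)) + (0 - 0))"
      proof (rule nn_integral_two_primitives[OF z _ _ _ _ _ DERIV_const])
        have chain: "((\<lambda>y. up_poly \<rho> (Suc k) ?u (?v - c * (y - s))) has_real_derivative
            real (2 * k + 2) * down_poly \<rho> k ?u (?v - c * (y - s)) * - c) (at y)" for y
          by (rule DERIV_chain2[OF up_poly_deriv]) (auto intro!: derivative_eq_intros)
        have L: "?L = (real (2 * k + 2) * c) * ?K"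
          by (simp add: fact_Suc algebra_simps)
        have "real (2 * k + 2) * c \<noteq> 0" using cpos by simp
        then show "((\<lambda>y. - (up_poly \<rho> (Suc k) ?u (?v - c * (y - s)) / ?L))
            has_real_derivative down_poly \<rho> k ?u (?v - c * (y - s)) / ?K) (at y)" for y
          using DERIV_cdivide[OF chain, of "- ?L" y] unfolding L
          by (simp del: of_nat_Suc of_nat_add fact_Suc power_Suc add: field_simps)
        show "continuous_on UNIV (\<lambda>y. down_poly \<rho> k ?u (?v - c * (y - s)) / ?K)"
          unfolding down_poly_def using cpos by (auto intro!: continuous_intros)
        show "0 \<le> down_poly \<rho> k ?u (?v - c * (y - s)) / ?K" if "s \<le> y" "y \<le> z" for y
        proof -
          have "x + c1 * (y - s) \<le> \<beta>" using that(2) c by (simp add: z_def field_simps)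
          from ord[OF this, of y] have "0 \<le> down_poly \<rho> k ?u (?v - c * (y - s))"
            using Suc.prems cpos unfolding U' V' by (intro down_poly_nonneg) auto
          then show ?thesis using cpos by simp
        qed
        show "?g y = ennreal (down_poly \<rho> k ?u (?v - c * (y - s)) / ?K)" if "s < y" "y < z" for y
          using B[of n "Suc i" y "x + c1 * (y - s)"] Suc.prems z that x'[of y] unfolding U' V' by simp
        show "?g y = ennreal 0" if "z < y" for y
          using x'[of y] that by (simp add: volume_below_above)
      qed auto
      also have "?v - c * (z - s) = \<rho> * ?u"
        using rho[of x s] by (simp add: z_def algebra_simps)
      finally show ?thesis by (simp add: up_poly_boundary)
    qed
  qed
  show "PROP ?B k" by (rule down_of_up[OF A])
qed

section \<open>Jump times of a counting path\<close>

text \<open>The time of jump number \<open>i\<close>, counted from \<open>0\<close>. Inserting \<open>t\<close> makes it a number in \<open>{0..t}\<close> even if the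
  jump does not occur by time \<open>t\<close>. A jump of size larger than one counts as several jumps at the
  same time.\<close>

definition jump_time :: "(real \<Rightarrow> nat) \<Rightarrow> real \<Rightarrow> nat \<Rightarrow> real" where
  "jump_time h t i = Inf (insert t {s \<in> {0..t}. i < h s})"

lemma jump_time_bounds:
  assumes "0 \<le> t"
  shows "0 \<le> jump_time h t i" "jump_time h t i \<le> t"
proof -
  have "bdd_below (insert t {s \<in> {0..t}. i < h s})"
    using assms by (intro bdd_belowI[of _ 0]) auto
  then show "jump_time h t i \<le> t" unfolding jump_time_def by (intro cInf_lower) auto
  show "0 \<le> jump_time h t i" unfolding jump_time_def
    using assms by (intro cInf_greatest) auto
qed

text \<open>The infimum is attained by right continuity: if \<open>h c \<le> i\<close>, then \<open>h\<close> keeps the value \<open>h c\<close> for a while,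
  so the infimum is larger than \<open>c\<close>.\<close>

lemma jump_time_le_iff:
  assumes mono: "mono_on {0..} h" and cont: "continuous (at_right c) h" and c: "0 \<le> c" "c < t"
  shows "jump_time h t i \<le> c \<longleftrightarrow> i < h c"
proof
  assume "i < h c"
  moreover have "bdd_below (insert t {s \<in> {0..t}. i < h s})"
    using c by (intro bdd_belowI[of _ 0]) auto
  ultimately show "jump_time h t i \<le> c"
    using c unfolding jump_time_def by (intro cInf_lower) auto
next
  assume le: "jump_time h t i \<le> c"
  show "i < h c"
  proof (rule ccontr)
    assume i: "\<not> i < h c"
    have "(h \<longlongrightarrow> h c) (at_right c)"
      using cont by (simp add: continuous_within)
    then have "eventually (\<lambda>s. h s \<in> {h c}) (at_right c)"
      by (rule topological_tendstoD) (auto simp: discrete_topology_class.open_discrete)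
    then obtain d where d: "c < d" "\<And>s. c < s \<Longrightarrow> s < d \<Longrightarrow> h s = h c"
      by (auto simp: eventually_at_right_field)
    have "min d t \<le> jump_time h t i"
      unfolding jump_time_def
    proof (rule cInf_greatest)
      fix s assume s: "s \<in> insert t {s \<in> {0..t}. i < h s}"
      show "min d t \<le> s"
      proof (rule ccontr)
        assume "\<not> min d t \<le> s"
        then have "i < h s" "0 \<le> s" "s < d" using s by auto
        moreover have "h s \<le> h c" if "s \<le> c"
          using mono that \<open>0 \<le> s\<close> c by (auto intro: mono_onD)
        ultimately show False using d(2)[of s] i by (cases "s \<le> c") auto
      qed
    qed simp
    with le d(1) c show False by simp
  qed
qed

lemma jump_time_le_iff':
  assumes "mono_on {0..} h" "\<And>c. 0 \<le> c \<Longrightarrow> continuous (at_right c) h"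
    and "0 \<le> c" "c \<le> t" "i < h t"
  shows "jump_time h t i \<le> c \<longleftrightarrow> i < h c"
  using jump_time_le_iff[of h c t i] jump_time_bounds(2)[of t h i] assms by (cases "c = t") auto

section \<open>Boxes in the simplex of switching times\<close>

lemma increasing_upto_map:
  "increasing_upto t s (map f [i..<n]) \<longleftrightarrow>
     s \<le> t \<and> (\<forall>j\<in>{i..<n}. s < f j \<and> f j \<le> t) \<and> (\<forall>k<n. \<forall>j\<in>{i..<k}. f j < f k)"
proof (induction "n - i" arbitrary: i s)
  case 0
  then show ?case by auto
next
  case (Suc m)
  then have i: "i < n" "m = n - Suc i" by auto
  have ins: "{i..<n} = insert i {Suc i..<n}" using i by auto
  have "increasing_upto t s (map f [i..<n]) \<longleftrightarrow> s < f i \<and> increasing_upto t (f i) (map f [Suc i..<n])"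
    using i by (simp add: upt_conv_Cons)
  also have "\<dots> \<longleftrightarrow> s < f i \<and> f i \<le> t \<and> (\<forall>j\<in>{Suc i..<n}. f i < f j \<and> f j \<le> t)
      \<and> (\<forall>k<n. \<forall>j\<in>{Suc i..<k}. f j < f k)"
    using Suc.hyps(1)[OF i(2), of "f i"] by simp
  also have "\<dots> \<longleftrightarrow> s \<le> t \<and> (\<forall>j\<in>{i..<n}. s < f j \<and> f j \<le> t) \<and> (\<forall>k<n. \<forall>j\<in>{i..<k}. f j < f k)"
    (is "?L \<longleftrightarrow> ?R")
  proof
    assume L: ?L
    have "f j < f k" if "k < n" "j \<in> {i..<k}" for j k
      using L that by (cases "j = i") auto
    with L show ?R unfolding ins by (auto intro: less_trans)
  next
    assume ?R with i show ?L by auto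
  qed
  finally show ?case .
qed

definition switch_simplex :: "real \<Rightarrow> nat \<Rightarrow> (nat \<Rightarrow> real) set" where
  "switch_simplex t n = {f \<in> space (PiM {0..<n} (\<lambda>_. lborel)). increasing_upto t 0 (map f [0..<n])}"

text \<open>Boxes whose sides follow one another in time; points in them have increasing coordinates, and
  membership of the jump times can be read off from increments over disjoint intervals.\<close>

definition separated :: "real \<Rightarrow> nat \<Rightarrow> (nat \<Rightarrow> real) \<Rightarrow> (nat \<Rightarrow> real) \<Rightarrow> bool" where
  "separated t n a b \<longleftrightarrow> (\<forall>i<n. 0 \<le> a i \<and> a i \<le> b i \<and> b i \<le> t \<and> (\<forall>j<i. b j \<le> a i))"

text \<open>The empty set is adjoined because two boxes may be disjoint, while the family has to be closed under
  intersection.\<close>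

definition separated_boxes :: "real \<Rightarrow> nat \<Rightarrow> (nat \<Rightarrow> real) set set" where
  "separated_boxes t n =
     insert {} {PiE {0..<n} (\<lambda>i. {a i<..b i}) |a b. separated t n a b}"

lemma separated_boxes_subset: 
  assumes "0 \<le> t" shows "separated_boxes t n \<subseteq> Pow (switch_simplex t n)"
proof -
  have "f \<in> switch_simplex t n" if ab: "separated t n a b" and f: "f \<in> PiE {0..<n} (\<lambda>i. {a i<..b i})" for a b f
  proof -
    have "f j < f k" if "k < n" "j < k" for j k
    proof -
      have "f j \<le> b j" "a k < f k" using f that by (auto simp: PiE_iff)
      moreover have "b j \<le> a k" using ab that by (auto simp: separated_def)
      ultimately show ?thesis by simp
    qed
    moreover have "0 < f j \<and> f j \<le> t" if "j < n" for j
    proof -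
      have "f j \<le> b j" "a j < f j" using f that by (auto simp: PiE_iff)
      moreover have "0 \<le> a j" "b j \<le> t" using ab that by (auto simp: separated_def)
      ultimately show ?thesis by simp
    qed
    ultimately show ?thesis
      using f assms by (auto simp: switch_simplex_def increasing_upto_map space_PiM PiE_iff)
  qed
  then show ?thesis unfolding separated_boxes_def by blast
qed

lemma Int_stable_separated_boxes: "Int_stable (separated_boxes t n)"
proof (rule Int_stableI)
  fix X Y assume X: "X \<in> separated_boxes t n" and Y: "Y \<in> separated_boxes t n"
  show "X \<inter> Y \<in> separated_boxes t n"
  proof (cases "X \<inter> Y = {}")
    case False
    with X Y obtain a b a' b' where
      ab: "separated t n a b" "X = PiE {0..<n} (\<lambda>i. {a i<..b i})"
        "separated t n a' b'" "Y = PiE {0..<n} (\<lambda>i. {a' i<..b' i})"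
      unfolding separated_boxes_def by blast
    let ?a = "\<lambda>i. max (a i) (a' i)" and ?b = "\<lambda>i. min (b i) (b' i)"
    have eq: "X \<inter> Y = PiE {0..<n} (\<lambda>i. {?a i<..?b i})"
      unfolding ab PiE_Int by (intro PiE_cong) auto
    obtain f where f: "f \<in> X \<inter> Y" using False by auto
    have le: "?a i \<le> ?b i" if "i < n" for i
    proof -
      have "f i \<in> {?a i<..?b i}" using f that unfolding eq by (auto simp: PiE_iff)
      then show ?thesis by (metis greaterThanAtMost_iff less_le_not_le less_le_trans nle_le)
    qed
    have "separated t n ?a ?b"
      unfolding separated_def
    proof (intro allI impI conjI)
      fix i assume i: "i < n"
      show "0 \<le> ?a i" using ab i by (auto simp: separated_def le_max_iff_disj)
      show "?b i \<le> t" using ab i by (auto simp: separated_def min_le_iff_disj)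
      show "?a i \<le> ?b i" by (rule le[OF i])
      fix j assume "j < i"
      then show "?b j \<le> ?a i" using ab i by (auto simp: separated_def min_le_iff_disj le_max_iff_disj)
    qed
    then show ?thesis unfolding eq separated_boxes_def
      by (intro insertI2 CollectI exI[of _ ?a] exI[of _ ?b]) simp
  qed (simp add: separated_boxes_def)
qed

text \<open>Countably many boxes suffice to exhaust the simplex, and also its part cut out by lower bounds
  \<open>c\<close> for the coordinates. Contiguous boxes with rational division points \<open>q\<close> do it: for a point \<open>f\<close>
  choose \<open>q i\<close> between \<open>f (i - 1)\<close> and \<open>f i\<close>, and above \<open>c i\<close>.\<close>

lemma rational_separated_boxes:
  assumes "0 \<le> t"
  obtains B where "countable B" "B \<subseteq> separated_boxes t n"
    "\<And>c. {f \<in> switch_simplex t n. \<forall>i<n. c i < f i}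
       = \<Union>{X \<in> B. \<forall>f\<in>X. \<forall>i<n. c i < f i}"
proof -
  define b where "b q j = (if Suc j < n then q (Suc j) else t)" for q and j
  define box where "box q = PiE {0..<n} (\<lambda>i. {q i<..b q i})" for q
  define B where "B = box ` {q \<in> PiE {0..<n} (\<lambda>_. \<rat>). separated t n q (b q)}"
  show thesis
  proof (rule that)
    show "countable B" unfolding B_def
      by (intro countable_image countable_subset[OF _ countable_PiE[of "{0..<n}" "\<lambda>_. \<rat>"]])
         (auto simp: countable_rat)
    show sub: "B \<subseteq> separated_boxes t n" unfolding B_def box_def separated_boxes_def by blast
    fix c :: "nat \<Rightarrow> real"
    show "{f \<in> switch_simplex t n. \<forall>i<n. c i < f i} = \<Union>{X \<in> B. \<forall>f\<in>X. \<forall>i<n. c i < f i}"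
    proof (intro equalityI subsetI)
      fix f assume "f \<in> {f \<in> switch_simplex t n. \<forall>i<n. c i < f i}"
      then have f: "f \<in> extensional {0..<n}" "0 \<le> t" and pos: "\<And>i. i < n \<Longrightarrow> 0 < f i \<and> f i \<le> t"
        and inc: "\<And>i j. i < n \<Longrightarrow> j < i \<Longrightarrow> f j < f i" and c: "\<And>i. i < n \<Longrightarrow> c i < f i"
        by (auto simp: switch_simplex_def increasing_upto_map space_PiM PiE_iff)
      define l where "l i = max (c i) (if i = 0 then 0 else f (i - 1))" for i
      have "\<exists>r\<in>\<rat>. l i < r \<and> r < f i" if "i < n" for i
        using that pos[of i] c[of i] inc[of i "i - 1"]
        by (intro Rats_dense_in_real) (auto simp: l_def)
      then obtain r where r: "\<And>i. i < n \<Longrightarrow> r i \<in> \<rat> \<and> l i < r i \<and> r i < f i" by metis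
      define q where "q = restrict r {0..<n}"
      have q: "q i \<in> \<rat>" "c i < q i" "0 < i \<Longrightarrow> f (i - 1) < q i" "i = 0 \<Longrightarrow> 0 < q i" "q i < f i" if "i < n" for i
        using r[OF that] that by (auto simp: q_def l_def)
      have fb: "f i \<le> b q i" if "i < n" for i
        using that pos[OF that] q(3)[of "Suc i"] by (auto simp: b_def)
      have q0: "0 < q i" if "i < n" for i
        using q(3,4)[OF that] pos[of "i - 1"] that by (cases "i = 0") fastforce+
      have le: "f j \<le> f i" if "j \<le> i" "i < n" for i j
        using inc[of i j] that by (cases "i = j") auto
      have "separated t n q (b q)"
        unfolding separated_def
      proof (intro allI impI conjI)
        fix i assume i: "i < n"
        show "0 \<le> q i" using q0[OF i] by simp
        show "q i \<le> b q i" using q(5)[OF i] fb[OF i] by simp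
        show "b q i \<le> t"
        proof (cases "Suc i < n")
          case True
          then show ?thesis using q(5)[of "Suc i"] pos[of "Suc i"] by (simp add: b_def)
        qed (simp add: b_def)
        fix j assume j: "j < i"
        then have bj: "b q j = q (Suc j)" using i by (simp add: b_def)
        show "b q j \<le> q i"
        proof (cases "Suc j = i")
          case False
          then have "q (Suc j) < f (Suc j)" "f (Suc j) \<le> f (i - 1)"
            using i j by (auto intro!: q le)
          moreover have "f (i - 1) < q i" using q(3)[OF i] j by simp
          ultimately show ?thesis unfolding bj by simp
        qed (simp add: bj)
      qed
      moreover have "q \<in> PiE {0..<n} (\<lambda>_. \<rat>)" using q(1) by (auto simp: q_def)
      ultimately have "box q \<in> B" unfolding B_def by blast
      moreover have "f \<in> box q" using f(1) q(5) fb by (auto simp: box_def PiE_iff)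
      moreover have "\<forall>g\<in>box q. \<forall>i<n. c i < g i"
      proof (intro ballI allI impI)
        fix g i assume "g \<in> box q" "i < n"
        then have "q i < g i" by (auto simp: box_def PiE_iff)
        with q(2)[OF \<open>i < n\<close>] show "c i < g i" by (rule less_trans)
      qed
      ultimately show "f \<in> \<Union>{X \<in> B. \<forall>f\<in>X. \<forall>i<n. c i < f i}" by blast
    next
      fix f assume "f \<in> \<Union>{X \<in> B. \<forall>f\<in>X. \<forall>i<n. c i < f i}"
      then obtain X where X: "X \<in> B" "f \<in> X" "\<forall>f\<in>X. \<forall>i<n. c i < f i" by blast
      show "f \<in> {f \<in> switch_simplex t n. \<forall>i<n. c i < f i}"
        using X sub separated_boxes_subset[OF assms, of n] by blast
    qed
  qed
qed

lemma sets_switch_simplex [measurable]: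
  "switch_simplex t n \<in> sets (PiM {0..<n} (\<lambda>_. lborel))"
proof -
  have "Measurable.pred (PiM {0..<n} (\<lambda>_. lborel)) (\<lambda>f. increasing_upto t 0 (map (\<lambda>j. f j) [0..<n]))"
    by (intro measurable_increasing_upto) auto
  then show ?thesis unfolding switch_simplex_def by measurable
qed

text \<open>The separated boxes generate: a lower bound on one coordinate describes a countable union of
  boxes, hence the coordinates are measurable for the generated sigma-algebra.\<close>

lemma sets_restrict_switch_simplex:
  assumes t: "0 \<le> t"
  shows "sets (restrict_space (PiM {0..<n} (\<lambda>_. lborel)) (switch_simplex t n))
    = sigma_sets (switch_simplex t n) (separated_boxes t n)" (is "sets (restrict_space ?P ?\<Delta>) = sigma_sets _ ?E")
proof (intro equalityI subsetI)
  obtain B where B: "countable B" "B \<subseteq> ?E"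
    "\<And>c. {f \<in> ?\<Delta>. \<forall>i<n. c i < f i} = \<Union>{X \<in> B. \<forall>f\<in>X. \<forall>i<n. c i < f i}"
    by (rule rational_separated_boxes[OF t, where n = n]) blast
  let ?S = "sigma ?\<Delta> ?E"
  have S: "sets ?S = sigma_sets ?\<Delta> ?E" "space ?S = ?\<Delta>"
    using separated_boxes_subset[OF t] by (auto simp: space_measure_of_conv)
  have \<Delta>: "f i > 0" "f \<in> space ?P" if "f \<in> ?\<Delta>" "i < n" for f i
    using that by (auto simp: switch_simplex_def increasing_upto_map)
  have "(\<lambda>f. f i) \<in> borel_measurable ?S" if i: "i < n" for i
    unfolding borel_measurable_iff_greater
  proof
    fix r :: real
    \<comment> \<open>The bounds \<open>0\<close> are void on the simplex.\<close>
    let ?c = "\<lambda>j. if j = i then max r 0 else 0"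
    have "{f \<in> space ?S. r < f i} = {f \<in> ?\<Delta>. \<forall>j<n. ?c j < f j}"
      unfolding S using \<Delta> i by auto
    also have "\<dots> = \<Union>{X \<in> B. \<forall>f\<in>X. \<forall>j<n. ?c j < f j}" by (rule B)
    also have "\<dots> \<in> sigma_sets ?\<Delta> ?E"
      using B(1,2) by (intro sigma_sets_UNION) (auto intro: countable_subset)
    finally show "{f \<in> space ?S. r < f i} \<in> sets ?S" by (simp only: S)
  qed
  then have "(\<lambda>f. \<lambda>i\<in>{0..<n}. f i) \<in> measurable ?S ?P"
    by (intro measurable_restrict) auto
  moreover have "(\<lambda>i\<in>{0..<n}. f i) = f" if "f \<in> ?\<Delta>" for f
    using that by (auto simp: switch_simplex_def space_PiM PiE_iff extensional_restrict)
  ultimately have id: "(\<lambda>f. f) \<in> measurable ?S ?P"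
    by (subst (asm) measurable_cong[where g = "\<lambda>f. f"]) (auto simp: S)
  fix A assume "A \<in> sets (restrict_space ?P ?\<Delta>)"
  then obtain A' where A': "A' \<in> sets ?P" "A = A' \<inter> ?\<Delta>"
    by (auto simp: sets_restrict_space)
  then show "A \<in> sigma_sets ?\<Delta> ?E"
    using measurable_sets[OF id, of A'] by (simp add: S)
next
  fix A assume A: "A \<in> sigma_sets ?\<Delta> ?E"
  have "X \<in> sets (restrict_space ?P ?\<Delta>)" if "X \<in> ?E" for X
  proof -
    have "X \<in> sets ?P" using that by (auto simp: separated_boxes_def intro!: sets_PiM_I_finite)
    moreover have "X \<subseteq> ?\<Delta>" using that separated_boxes_subset[OF t] by blast
    ultimately show ?thesis by (subst sets_restrict_space_iff) auto
  qed
  then have "sigma_sets ?\<Delta> ?E \<subseteq> sets (restrict_space ?P ?\<Delta>)"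
    using sets.sigma_sets_subset[of ?E "restrict_space ?P ?\<Delta>"]
    by (auto simp: space_restrict_space switch_simplex_def Int_absorb2)
  then show "A \<in> sets (restrict_space ?P ?\<Delta>)" using A by blast
qed

lemma below_trivial: "below t 1 0 0 0 s ys"
  by (induction ys arbitrary: s) auto

text \<open>The simplex is the set of switching sequences for a particle at rest below the level.\<close>

lemma emeasure_switch_simplex:
  assumes "0 \<le> t"
  shows "emeasure (PiM {0..<n} (\<lambda>_. lborel)) (switch_simplex t n) = ennreal (t ^ n / fact n)"
proof -
  have "switch_simplex t n = switch_times_below t 1 0 0 0 0 0 n"
    by (auto simp: switch_simplex_def switch_times_below_def below_trivial)
  then show ?thesis
    using volume_below_free[of 0 t 0 0 0 0 1 0 n] assms by (simp add: volume_below_def)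
qed

section \<open>Jump times of the Poisson process given their number\<close>

context poisson_process
begin

text \<open>The case \<open>s = u\<close> is included, where \<open>0 ^ 0 = 1\<close> gives the right value for \<open>k = 0\<close>.\<close>

lemma prob_increment:
  assumes "0 \<le> s" "s \<le> u"
  shows "prob {\<omega> \<in> space M. N u \<omega> - N s \<omega> = k}
    = (lam * (u - s)) ^ k / fact k * exp (- (lam * (u - s)))"
proof (cases "s = u")
  case True
  then show ?thesis by (cases k) (simp_all add: prob_space)
next
  case False
  then have su: "s < u" using assms by simp
  have [measurable]: "N s \<in> measurable M (count_space UNIV)" "N u \<in> measurable M (count_space UNIV)"
    using random_variable_N assms by auto
  have "prob {\<omega> \<in> space M. N u \<omega> - N s \<omega> = k}
      = measure (distr M (count_space UNIV) (\<lambda>\<omega>. N u \<omega> - N s \<omega>)) {k}"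
    by (subst measure_distr) (auto simp: vimage_def Int_def conj_commute)
  also have "\<dots> = pmf (poisson_pmf (lam * (u - s))) k"
    using poisson_increments[OF assms(1) su] by (simp add: pmf.rep_eq)
  also have "\<dots> = (lam * (u - s)) ^ k / fact k * exp (- (lam * (u - s)))"
    using su rate_pos by (intro pmf_poisson) simp
  finally show ?thesis .
qed

lemma prob_count_eq:
  assumes "0 \<le> t"
  shows "prob {\<omega> \<in> space M. N t \<omega> = n} = (lam * t) ^ n / fact n * exp (- (lam * t))"
proof -
  have "{\<omega> \<in> space M. N t \<omega> = n} = {\<omega> \<in> space M. N t \<omega> - N 0 \<omega> = n}"
    using N_0 by auto
  then show ?thesis using prob_increment[of 0 t n] assms by simp
qed

text \<open>The measurable space is a parameter because the jump times are needed both as random variables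
  and as measurable functions for the sigma-algebra generated by \<open>N\<close>.\<close>

lemma jump_time_measurable:
  assumes t: "0 \<le> t" and sp: "space M' = space M"
    and N: "\<And>s. 0 \<le> s \<Longrightarrow> N s \<in> measurable M' (count_space UNIV)"
  shows "(\<lambda>\<omega>. jump_time (\<lambda>s. N s \<omega>) t i) \<in> borel_measurable M'"
  unfolding borel_measurable_iff_le
proof
  fix a
  consider "a < 0" | "t \<le> a" | "0 \<le> a" "a < t" by linarith
  then show "{\<omega> \<in> space M'. jump_time (\<lambda>s. N s \<omega>) t i \<le> a} \<in> sets M'"
  proof cases
    case 1
    then have "\<not> jump_time (\<lambda>s. N s \<omega>) t i \<le> a" for \<omega>
      using jump_time_bounds(1)[OF t, of "\<lambda>s. N s \<omega>" i] by simp
    then show ?thesis by simp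
  next
    case 2
    then have "jump_time (\<lambda>s. N s \<omega>) t i \<le> a" for \<omega>
      using jump_time_bounds(2)[OF t, of "\<lambda>s. N s \<omega>" i] by simp
    then show ?thesis by simp
  next
    case 3
    note [measurable] = N[OF 3(1)]
    have "{\<omega> \<in> space M'. jump_time (\<lambda>s. N s \<omega>) t i \<le> a} = {\<omega> \<in> space M'. i < N a \<omega>}"
      using jump_time_le_iff[of "\<lambda>s. N s _" a t i] mono_N right_continuous_N 3 unfolding sp by blast
    then show ?thesis by simp
  qed
qed

text \<open>The sequence \<open>\<tau>\<close> is \<open>0, a 0, b 0, a 1, b 1, \<dots>, b (n - 1), t, t, \<dots>\<close>. Both sides say that \<open>N\<close> has the value
  \<open>m div 2\<close> at \<open>\<tau> m\<close>. For the jump times this uses the separation: \<open>N (b j) \<le> N (a i)\<close> for \<open>j < i\<close> squeezes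
  \<open>N (a i) \<le> i\<close> and \<open>N (b i) > i\<close> to equalities.\<close>

lemma jump_times_box_iff:
  fixes n :: nat and a b :: "nat \<Rightarrow> real" and t :: real
  defines "\<tau> \<equiv> \<lambda>m. case m of 0 \<Rightarrow> 0 | Suc m \<Rightarrow> if 2 * n \<le> m then t else if even m then a (m div 2) else b (m div 2)"
  assumes ab: "separated t n a b" and t: "0 \<le> t" and \<omega>: "\<omega> \<in> space M"
  shows "N t \<omega> = n \<and> (\<forall>i<n. jump_time (\<lambda>s. N s \<omega>) t i \<in> {a i<..b i})
    \<longleftrightarrow> (\<forall>m<Suc (2 * n). N (\<tau> (Suc m)) \<omega> - N (\<tau> m) \<omega> = m mod 2)"
    and "incseq \<tau>"
proof -
  have \<tau>: "\<tau> 0 = 0" "\<tau> (Suc (2 * n)) = t" "\<And>i. i < n \<Longrightarrow> \<tau> (Suc (2 * i)) = a i"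
    "\<And>i. i < n \<Longrightarrow> \<tau> (Suc (Suc (2 * i))) = b i"
    by (auto simp: \<tau>_def)
  have sep: "0 \<le> a i" "a i \<le> b i" "b i \<le> t" "j < i \<Longrightarrow> b j \<le> a i" if "i < n" for i j
    using ab that by (auto simp: separated_def)
  show inc: "incseq \<tau>"
  proof (rule incseq_SucI)
    fix m
    have "m = 0 \<or> (\<exists>i. m = Suc (2 * i)) \<or> (\<exists>i. m = Suc (Suc (2 * i)))" by presburger
    then consider "m = 0" | i where "m = Suc (2 * i)" | i where "m = Suc (Suc (2 * i))" by blast
    then show "\<tau> m \<le> \<tau> (Suc m)"
    proof cases
      case 1 then show ?thesis using t sep(1)[of 0] by (simp add: \<tau>_def)
    next
      case (2 i)
      then show ?thesis using sep[of i] by (cases "i < n") (auto simp: \<tau>_def)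
    next
      case (3 i)
      then show ?thesis using sep(3)[of i] sep(4)[of "Suc i" i] by (cases "i < n") (auto simp: \<tau>_def)
    qed
  qed
  have mono: "N r \<omega> \<le> N s \<omega>" if "0 \<le> r" "r \<le> s" for r s
    using mono_N[OF \<omega>] that by (auto simp: mono_on_def)
  have \<tau>_nonneg: "0 \<le> \<tau> m" for m
    using incseqD[OF inc, of 0 m] \<tau>(1) by simp
  have N\<tau>: "N (\<tau> m) \<omega> \<le> N (\<tau> m') \<omega>" if "m \<le> m'" for m m'
    using mono[OF \<tau>_nonneg incseqD[OF inc that]] .
  have jt: "jump_time (\<lambda>s. N s \<omega>) t i \<le> c \<longleftrightarrow> i < N c \<omega>" if "0 \<le> c" "c \<le> t" "i < N t \<omega>" for c i
    using that mono_N[OF \<omega>] right_continuous_N[OF \<omega>] by (intro jump_time_le_iff') auto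
  let ?C = "\<forall>m\<le>Suc (2 * n). N (\<tau> m) \<omega> = m div 2"
  have "(\<forall>m<Suc (2 * n). N (\<tau> (Suc m)) \<omega> - N (\<tau> m) \<omega> = m mod 2) \<longleftrightarrow> ?C"
  proof
    assume *: "\<forall>m<Suc (2 * n). N (\<tau> (Suc m)) \<omega> - N (\<tau> m) \<omega> = m mod 2"
    show ?C
    proof (intro allI impI)
      fix m assume "m \<le> Suc (2 * n)"
      then show "N (\<tau> m) \<omega> = m div 2"
      proof (induction m)
        case 0 then show ?case using N_0[OF \<omega>] \<tau>(1) by simp
      next
        case (Suc m)
        have "N (\<tau> (Suc m)) \<omega> - N (\<tau> m) \<omega> = m mod 2"
          by (rule *[rule_format]) (use Suc.prems in simp)
        then have "N (\<tau> (Suc m)) \<omega> = N (\<tau> m) \<omega> + m mod 2" using N\<tau>[of m "Suc m"] by linarith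
        moreover have "N (\<tau> m) \<omega> = m div 2" by (rule Suc.IH) (use Suc.prems in simp)
        moreover have "m div 2 + m mod 2 = Suc m div 2" by presburger
        ultimately show ?case by simp
      qed
    qed
  next
    assume *: ?C
    show "\<forall>m<Suc (2 * n). N (\<tau> (Suc m)) \<omega> - N (\<tau> m) \<omega> = m mod 2"
    proof (intro allI impI)
      fix m assume "m < Suc (2 * n)"
      then have "N (\<tau> (Suc m)) \<omega> = Suc m div 2" "N (\<tau> m) \<omega> = m div 2" using * by auto
      moreover have "Suc m div 2 - m div 2 = m mod 2" by presburger
      ultimately show "N (\<tau> (Suc m)) \<omega> - N (\<tau> m) \<omega> = m mod 2" by simp
    qed
  qed
  also have "?C \<longleftrightarrow> N t \<omega> = n \<and> (\<forall>i<n. jump_time (\<lambda>s. N s \<omega>) t i \<in> {a i<..b i})"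
  proof
    assume C: ?C
    then have Nt: "N t \<omega> = n" using \<tau>(2) by force
    moreover have "jump_time (\<lambda>s. N s \<omega>) t i \<in> {a i<..b i}" if i: "i < n" for i
    proof -
      have "N (a i) \<omega> = i" "N (b i) \<omega> = Suc i"
        using C[rule_format, of "Suc (2 * i)"] C[rule_format, of "Suc (Suc (2 * i))"] \<tau>(3,4)[OF i] i by auto
      then show ?thesis using jt[of "a i" i] jt[of "b i" i] sep[OF i] Nt i by auto
    qed
    ultimately show "N t \<omega> = n \<and> (\<forall>i<n. jump_time (\<lambda>s. N s \<omega>) t i \<in> {a i<..b i})" by blast
  next
    assume *: "N t \<omega> = n \<and> (\<forall>i<n. jump_time (\<lambda>s. N s \<omega>) t i \<in> {a i<..b i})"
    have ai: "N (a i) \<omega> \<le> i" and bi: "Suc i \<le> N (b i) \<omega>" if "i < n" for i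
      using * jt[of "a i" i] jt[of "b i" i] sep[OF that] that by auto
    show ?C
    proof (intro allI impI)
      fix m assume m: "m \<le> Suc (2 * n)"
      consider "m = 0" | i where "m = Suc (2 * i)" "i < n" | i where "m = Suc (Suc (2 * i))" "i < n" | "m = Suc (2 * n)"
      proof -
        have "m = 0 \<or> (\<exists>i. m = Suc (2 * i)) \<or> (\<exists>i. m = Suc (Suc (2 * i)))" by presburger
        then show thesis
        proof (elim disjE exE)
          fix i assume i: "m = Suc (2 * i)"
          then have "i < n \<or> i = n" using m by auto
          then show thesis using i that(2,4) by blast
        next
          fix i assume i: "m = Suc (Suc (2 * i))"
          then have "i < n" using m by linarith
          then show thesis using i that(3) by blast
        qed (rule that(1))
      qed
      then show "N (\<tau> m) \<omega> = m div 2"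
      proof cases
        case 1 then show ?thesis using N_0[OF \<omega>] \<tau>(1) by simp
      next
        case (2 i)
        have "i \<le> N (a i) \<omega>"
        proof (cases i)
          case (Suc j)
          then have j: "j < n" "j < i" using 2(2) by auto
          have "N (b j) \<omega> \<le> N (a i) \<omega>"
            using sep(1,2)[OF j(1)] sep(4)[OF 2(2) j(2)] by (intro mono) auto
          then show ?thesis using bi[OF j(1)] Suc by simp
        qed simp
        then show ?thesis using ai[OF 2(2)] \<tau>(3)[OF 2(2)] 2(1) by simp
      next
        case (3 i)
        have "N (b i) \<omega> \<le> Suc i"
        proof (cases "Suc i < n")
          case True
          have "N (b i) \<omega> \<le> N (a (Suc i)) \<omega>"
            using sep(1,2)[OF 3(2)] sep(4)[OF True, of i] by (intro mono) auto
          then show ?thesis using ai[OF True] by simp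
        next
          case False
          then have "Suc i = n" using 3(2) by simp
          moreover have "N (b i) \<omega> \<le> N t \<omega>"
            using sep(1,2,3)[OF 3(2)] by (intro mono) auto
          ultimately show ?thesis using * by simp
        qed
        then show ?thesis using bi[OF 3(2)] \<tau>(4)[OF 3(2)] 3(1) by simp
      next
        case 4 then show ?thesis using * \<tau>(2) by simp
      qed
    qed
  qed
  finally show "N t \<omega> = n \<and> (\<forall>i<n. jump_time (\<lambda>s. N s \<omega>) t i \<in> {a i<..b i})
    \<longleftrightarrow> (\<forall>m<Suc (2 * n). N (\<tau> (Suc m)) \<omega> - N (\<tau> m) \<omega> = m mod 2)" by blast
qed

lemma prob_jump_times_box:
  assumes ab: "separated t n a b" and t: "0 \<le> t"
  shows "prob {\<omega> \<in> space M. N t \<omega> = n \<and> (\<forall>i<n. jump_time (\<lambda>s. N s \<omega>) t i \<in> {a i<..b i})}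
    = lam ^ n * exp (- (lam * t)) * (\<Prod>i<n. b i - a i)"
proof -
  define \<tau> where "\<tau> = (\<lambda>m. case m of 0 \<Rightarrow> 0 | Suc m \<Rightarrow> if 2 * n \<le> m then t
    else if even m then a (m div 2) else b (m div 2))"
  obtain \<omega>0 where "\<omega>0 \<in> space M" using not_empty by blast
  then have inc: "incseq \<tau>" unfolding \<tau>_def by (rule jump_times_box_iff(2)[OF ab t])
  have \<tau>0: "0 \<le> \<tau> m" for m
    using incseqD[OF inc, of 0 m] by (simp add: \<tau>_def)
  let ?X = "\<lambda>m \<omega>. N (\<tau> (Suc m)) \<omega> - N (\<tau> m) \<omega>"
  have "{\<omega> \<in> space M. N t \<omega> = n \<and> (\<forall>i<n. jump_time (\<lambda>s. N s \<omega>) t i \<in> {a i<..b i})}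
      = {\<omega> \<in> space M. \<forall>m<Suc (2 * n). ?X m \<omega> = m mod 2}"
    using jump_times_box_iff(1)[OF ab t] unfolding \<tau>_def by blast
  also have "\<dots> = (\<Inter>m\<in>{..<Suc (2 * n)}. ?X m -` {m mod 2} \<inter> space M)"
    by (auto 0 3)
  also have "prob \<dots> = (\<Prod>m<Suc (2 * n). prob (?X m -` {m mod 2} \<inter> space M))"
  proof (rule indep_varsD_finite)
    have "mono_on {..Suc (2 * n)} \<tau>" using inc by (auto simp: mono_on_def incseq_def)
    with \<tau>0 show "indep_vars (\<lambda>_. count_space UNIV) ?X {..<Suc (2 * n)}"
      by (intro independent_increments)
  qed auto
  also have "\<dots> = (\<Prod>m<Suc (2 * n). (lam * (\<tau> (Suc m) - \<tau> m)) ^ (m mod 2) * exp (- (lam * (\<tau> (Suc m) - \<tau> m))))"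
  proof (intro prod.cong refl)
    fix m
    have "?X m -` {m mod 2} \<inter> space M = {\<omega> \<in> space M. ?X m \<omega> = m mod 2}" by auto
    moreover have "fact (m mod 2) = (1::real)" by (cases "even m") (auto simp: odd_iff_mod_2_eq_one)
    ultimately show "prob (?X m -` {m mod 2} \<inter> space M)
        = (lam * (\<tau> (Suc m) - \<tau> m)) ^ (m mod 2) * exp (- (lam * (\<tau> (Suc m) - \<tau> m)))"
      using prob_increment[OF \<tau>0 incseqD[OF inc, of m "Suc m"], of "m mod 2"] by simp
  qed
  also have "\<dots> = (\<Prod>m<Suc (2 * n). (lam * (\<tau> (Suc m) - \<tau> m)) ^ (m mod 2))
      * exp (\<Sum>m<Suc (2 * n). - (lam * (\<tau> (Suc m) - \<tau> m)))"
    by (simp only: prod.distrib exp_sum finite_lessThan)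
  also have "(\<Sum>m<Suc (2 * n). - (lam * (\<tau> (Suc m) - \<tau> m))) = - (lam * t)"
    unfolding sum_negf sum_distrib_left[symmetric] sum_lessThan_telescope by (simp add: \<tau>_def)
  also have "(\<Prod>m<Suc (2 * n). (lam * (\<tau> (Suc m) - \<tau> m)) ^ (m mod 2)) = (\<Prod>i<n. lam * (b i - a i))"
  proof -
    have "(\<Prod>m<Suc (2 * n). f m ^ (m mod 2)) = (\<Prod>i<n. f (Suc (2 * i)))" for f :: "nat \<Rightarrow> real"
      by (induction n) auto
    then show ?thesis by (auto simp: \<tau>_def intro!: prod.cong)
  qed
  finally show ?thesis by (simp add: prod.distrib)
qed

text \<open>Two measures on the simplex that agree on a generating family of boxes closed under
  intersection.\<close>

lemma jump_times_law:
  assumes t: "0 \<le> t" and A: "A \<in> sets (PiM {0..<n} (\<lambda>_. lborel))" "A \<subseteq> switch_simplex t n"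
  shows "emeasure M {\<omega> \<in> space M. N t \<omega> = n \<and> (\<lambda>i\<in>{0..<n}. jump_time (\<lambda>s. N s \<omega>) t i) \<in> A}
    = ennreal (lam ^ n * exp (- (lam * t))) * emeasure (PiM {0..<n} (\<lambda>_. lborel)) A"
proof -
  interpret L: product_sigma_finite "\<lambda>_::nat. lborel :: real measure" ..
  let ?P = "PiM {0..<n} (\<lambda>_. lborel :: real measure)"
  let ?\<Delta> = "switch_simplex t n"
  let ?J = "\<lambda>\<omega>. \<lambda>i\<in>{0..<n}. jump_time (\<lambda>s. N s \<omega>) t i"
  let ?E = "{\<omega> \<in> space M. N t \<omega> = n}"
  let ?c = "ennreal (lam ^ n * exp (- (lam * t)))"
  have [measurable]: "N t \<in> measurable M (count_space UNIV)" by (rule random_variable_N[OF t])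
  have [measurable]: "(\<lambda>\<omega>. jump_time (\<lambda>s. N s \<omega>) t i) \<in> borel_measurable M" for i
    by (rule jump_time_measurable[OF t refl random_variable_N])
  have [measurable]: "?J \<in> measurable M ?P" by (intro measurable_restrict) simp
  define \<mu> where "\<mu> = restrict_space (distr (density M (indicator ?E)) ?P ?J) ?\<Delta>"
  define \<nu> where "\<nu> = restrict_space (scale_measure ?c ?P) ?\<Delta>"
  have \<mu>: "emeasure \<mu> X = emeasure M {\<omega> \<in> space M. N t \<omega> = n \<and> ?J \<omega> \<in> X}"
    if X: "X \<in> sets ?P" "X \<subseteq> ?\<Delta>" for X
  proof -
    have "emeasure \<mu> X = emeasure (distr (density M (indicator ?E)) ?P ?J) X"
      unfolding \<mu>_def using X(2) by (intro emeasure_restrict_space) auto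
    also have "\<dots> = emeasure (density M (indicator ?E)) (?J -` X \<inter> space M)"
      using X(1) by (subst emeasure_distr) auto
    also have "\<dots> = emeasure M (?E \<inter> (?J -` X \<inter> space M))"
      using X(1) by (subst emeasure_density) (auto simp: indicator_inter_arith[symmetric] nn_integral_indicator)
    also have "?E \<inter> (?J -` X \<inter> space M) = {\<omega> \<in> space M. N t \<omega> = n \<and> ?J \<omega> \<in> X}" by auto
    finally show ?thesis .
  qed
  have \<nu>: "emeasure \<nu> X = ?c * emeasure ?P X" if "X \<subseteq> ?\<Delta>" for X
    unfolding \<nu>_def using that by (subst emeasure_restrict_space) auto
  have box: "X \<in> sets ?P" "X \<subseteq> ?\<Delta>" if "X \<in> separated_boxes t n" for X
    using that separated_boxes_subset[OF t, of n]
    by (auto simp: separated_boxes_def intro!: sets_PiM_I_finite)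
  obtain B where B: "countable B" "B \<subseteq> separated_boxes t n"
    "\<And>c. {f \<in> ?\<Delta>. \<forall>i<n. c i < f i} = \<Union>{X \<in> B. \<forall>f\<in>X. \<forall>i<n. c i < f i}"
    by (rule rational_separated_boxes[OF t, where n = n]) blast
  have "\<mu> = \<nu>"
  proof (rule measure_eqI_generator_eq_countable[OF Int_stable_separated_boxes separated_boxes_subset[OF t]])
    fix X assume X: "X \<in> separated_boxes t n"
    show "emeasure \<mu> X = emeasure \<nu> X"
    proof (cases "X = {}")
      case False
      then obtain a b where ab: "separated t n a b" "X = PiE {0..<n} (\<lambda>i. {a i<..b i})"
        using X unfolding separated_boxes_def by auto
      have "{\<omega> \<in> space M. N t \<omega> = n \<and> ?J \<omega> \<in> X}
          = {\<omega> \<in> space M. N t \<omega> = n \<and> (\<forall>i<n. jump_time (\<lambda>s. N s \<omega>) t i \<in> {a i<..b i})}"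
        unfolding ab by (auto simp: PiE_iff)
      then have "emeasure \<mu> X = ennreal (lam ^ n * exp (- (lam * t)) * (\<Prod>i<n. b i - a i))"
        using \<mu>[OF box[OF X]] prob_jump_times_box[OF ab(1) t] by (simp add: emeasure_eq_measure)
      also have "\<dots> = ?c * (\<Prod>i<n. ennreal (b i - a i))"
        using ab(1) rate_pos
        by (subst prod_ennreal) (auto simp: separated_def intro!: ennreal_mult prod_nonneg)
      also have "(\<Prod>i<n. ennreal (b i - a i)) = emeasure ?P X"
        unfolding ab(2) using ab(1)
        by (subst L.emeasure_PiM) (auto simp: separated_def lessThan_atLeast0 intro!: prod.cong)
      finally show ?thesis using \<nu>[OF box(2)[OF X]] by simp
    qed simp
  next
    show "sets \<mu> = sigma_sets ?\<Delta> (separated_boxes t n)" "sets \<nu> = sigma_sets ?\<Delta> (separated_boxes t n)"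
      unfolding \<mu>_def \<nu>_def sets_restrict_switch_simplex[OF t, symmetric]
      by (auto simp: sets_restrict_space)
    show "B \<subseteq> separated_boxes t n" "countable B" by fact+
    have "B \<subseteq> Pow ?\<Delta>" using B(2) separated_boxes_subset[OF t] by blast
    moreover have "f \<in> \<Union>B" if "f \<in> ?\<Delta>" for f
      using that B(3)[of "\<lambda>_. 0"] by (auto simp: switch_simplex_def increasing_upto_map)
    ultimately show "\<Union>B = ?\<Delta>" by blast
    show "emeasure \<mu> X \<noteq> \<infinity>" if "X \<in> B" for X
      using \<mu>[OF box] that B(2) by auto
  qed
  then show ?thesis using \<mu>[OF A] \<nu>[OF A(2)] by simp
qed

text \<open>The simplex has the same mass as \<open>N t = n\<close>, so almost surely all jumps before \<open>t\<close> have size one, and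
  conditions on the jump times may be restricted to the simplex.\<close>

lemma prob_jump_times:
  assumes t: "0 \<le> t" and Q: "Measurable.pred (PiM {0..<n} (\<lambda>_. lborel)) Q"
  shows "prob {\<omega> \<in> space M. N t \<omega> = n \<and> Q (\<lambda>i\<in>{0..<n}. jump_time (\<lambda>s. N s \<omega>) t i)}
    = lam ^ n * exp (- (lam * t)) * measure (PiM {0..<n} (\<lambda>_. lborel)) {f \<in> switch_simplex t n. Q f}"
proof -
  let ?P = "PiM {0..<n} (\<lambda>_. lborel :: real measure)"
  let ?J = "\<lambda>\<omega>. \<lambda>i\<in>{0..<n}. jump_time (\<lambda>s. N s \<omega>) t i"
  let ?\<Delta> = "switch_simplex t n"
  let ?c = "lam ^ n * exp (- (lam * t))"
  have c: "0 \<le> ?c" using rate_pos by simp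
  note [measurable] = Q
  have [measurable]: "N t \<in> measurable M (count_space UNIV)" by (rule random_variable_N[OF t])
  have [measurable]: "(\<lambda>\<omega>. jump_time (\<lambda>s. N s \<omega>) t i) \<in> borel_measurable M" for i
    by (rule jump_time_measurable[OF t refl random_variable_N])
  have [measurable]: "?J \<in> measurable M ?P" by (intro measurable_restrict) simp
  have law: "prob {\<omega> \<in> space M. N t \<omega> = n \<and> ?J \<omega> \<in> A} = ?c * measure ?P A"
    if A: "A \<in> sets ?P" "A \<subseteq> ?\<Delta>" for A
    using jump_times_law[OF t A] c by (simp add: measure_def enn2real_mult)
  have "prob {\<omega> \<in> space M. N t \<omega> = n \<and> ?J \<omega> \<in> ?\<Delta>} = ?c * (t ^ n / fact n)"
    using law[of ?\<Delta>] t by (simp add: measure_def emeasure_switch_simplex)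
  also have "\<dots> = prob {\<omega> \<in> space M. N t \<omega> = n}"
    using prob_count_eq[OF t, of n] by (simp add: power_mult_distrib)
  finally have full: "prob {\<omega> \<in> space M. N t \<omega> = n \<and> ?J \<omega> \<in> ?\<Delta>} = prob {\<omega> \<in> space M. N t \<omega> = n}" .
  have "prob ({\<omega> \<in> space M. N t \<omega> = n} - {\<omega> \<in> space M. N t \<omega> = n \<and> ?J \<omega> \<in> ?\<Delta>}) = 0"
    using full by (subst finite_measure_Diff) auto
  then have "AE \<omega> in M. \<omega> \<notin> {\<omega> \<in> space M. N t \<omega> = n} - {\<omega> \<in> space M. N t \<omega> = n \<and> ?J \<omega> \<in> ?\<Delta>}"
    by (subst (asm) prob_eq_0) auto
  then have "prob {\<omega> \<in> space M. N t \<omega> = n \<and> Q (?J \<omega>)} = prob {\<omega> \<in> space M. N t \<omega> = n \<and> ?J \<omega> \<in> {f \<in> ?\<Delta>. Q f}}"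
    by (intro finite_measure_eq_AE) auto
  also have "\<dots> = ?c * measure ?P {f \<in> ?\<Delta>. Q f}"
  proof (rule law)
    have "{f \<in> ?\<Delta>. Q f} = ?\<Delta> \<inter> {f \<in> space ?P. Q f}"
      by (auto simp: switch_simplex_def)
    then show "{f \<in> ?\<Delta>. Q f} \<in> sets ?P" by simp
  qed auto
  finally show ?thesis .
qed

end

section \<open>Sample paths of the telegraph process\<close>

text \<open>A monotone function is Borel; extending \<open>h\<close> to the left by the constant \<open>h 0\<close> makes it monotone on
  the whole line.\<close>

lemma integrable_step_path:
  fixes h :: "real \<Rightarrow> nat" and g :: "nat \<Rightarrow> real"
  assumes mono: "mono_on {0..} h" and g: "\<And>i. \<bar>g i\<bar> \<le> C" and a: "0 \<le> a"
  shows "(\<lambda>r. g (h r)) integrable_on {a..b}"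
proof -
  have "mono (\<lambda>r. real (h (max 0 r)))"
    using mono by (auto simp: mono_def mono_on_def)
  then have [measurable]: "(\<lambda>r. real (h (max 0 r))) \<in> borel_measurable borel"
    by (rule borel_measurable_mono)
  have [measurable]: "g \<in> borel_measurable (count_space UNIV)" by simp
  have "(\<lambda>r. g (nat \<lfloor>real (h (max 0 r))\<rfloor>)) \<in> borel_measurable borel" by measurable
  then have m: "(\<lambda>r. g (h (max 0 r))) \<in> borel_measurable borel" by simp
  have "set_integrable lborel {a..b} (\<lambda>r. g (h (max 0 r)))"
    unfolding set_integrable_def
  proof (rule integrableI_bounded_set_indicator)
    show "AE r in lborel. r \<in> {a..b} \<longrightarrow> norm (g (h (max 0 r))) \<le> C" using g by auto
    show "emeasure lborel {a..b} < \<infinity>" by (cases "a \<le> b") auto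
  qed (use m in auto)
  then have "(\<lambda>r. g (h (max 0 r))) integrable_on {a..b}" by (rule set_borel_integral_eq_integral)
  then show ?thesis using a by (auto cong: integrable_cong elim!: integrable_eq)
qed

lemma integral_step_path_linear:
  fixes h :: "real \<Rightarrow> nat" and g :: "nat \<Rightarrow> real"
  assumes int: "(\<lambda>r. g (h r)) integrable_on {0..b}" and ab: "0 \<le> a" "a \<le> b"
    and const: "\<And>r. a \<le> r \<Longrightarrow> r < b \<Longrightarrow> h r = i"
  shows "integral {0..b} (\<lambda>r. g (h r)) = integral {0..a} (\<lambda>r. g (h r)) + g i * (b - a)"
proof -
  have "integral {a..b} (\<lambda>r. g (h r)) = integral {a..b} (\<lambda>r. g i)"
    by (rule integral_spike[of "{b}"]) (auto simp: const)
  also have "\<dots> = g i * (b - a)" using ab by simp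
  finally show ?thesis
    using Henstock_Kurzweil_Integration.integral_combine[OF ab int] by simp
qed

lemma affine_below_iff:
  fixes x v \<beta> :: real
  assumes "s \<le> y"
  shows "(\<forall>r\<in>{s..y}. x + v * (r - s) < \<beta>) \<longleftrightarrow> x < \<beta> \<and> x + v * (y - s) < \<beta>"
proof
  assume "\<forall>r\<in>{s..y}. x + v * (r - s) < \<beta>"
  from bspec[OF this, of s] bspec[OF this, of y] assms
  show "x < \<beta> \<and> x + v * (y - s) < \<beta>" by simp
next
  assume *: "x < \<beta> \<and> x + v * (y - s) < \<beta>"
  show "\<forall>r\<in>{s..y}. x + v * (r - s) < \<beta>"
  proof
    fix r assume r: "r \<in> {s..y}"
    show "x + v * (r - s) < \<beta>"
    proof (cases "0 \<le> v")
      case True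
      then have "v * (r - s) \<le> v * (y - s)" using r by (intro mult_left_mono) auto
      with * show ?thesis by linarith
    next
      case False
      then have "v * (r - s) \<le> 0" using r by (intro mult_nonpos_nonneg) auto
      with * show ?thesis by linarith
    qed
  qed
qed

text \<open>Induction over the jumps that remain. The time \<open>s\<close> is the last vertex that has been dealt with;
  before \<open>s\<close> at most \<open>i\<close> jumps have occurred, and from \<open>s\<close> on at least \<open>i\<close>. If several jumps coincide, the
  next vertex is again at \<open>s\<close> and the corresponding piece of the path degenerates to a point, so the
  equivalence covers coinciding jumps too.\<close>

lemma path_below_iff:
  fixes h :: "real \<Rightarrow> nat" and g :: "nat \<Rightarrow> real"
  assumes mono: "mono_on {0..} h" and cont: "\<And>r. 0 \<le> r \<Longrightarrow> continuous (at_right r) h"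
    and h0: "h 0 = 0" and t: "0 \<le> t" and g: "\<And>i. g (Suc (Suc i)) = g i"
  shows "(\<forall>r\<in>{0..t}. integral {0..r} (\<lambda>x. g (h x)) < \<beta>)
    \<longleftrightarrow> below t \<beta> (g 0) (g 1) 0 0 (map (jump_time h t) [0..<h t])"
proof -
  let ?P = "\<lambda>r. integral {0..r} (\<lambda>x. g (h x))" and ?\<tau> = "jump_time h t"
  have g01: "g i = (if even i then g 0 else g 1)" for i
    by (induction i rule: nat_induct2) (auto simp: g)
  have int: "(\<lambda>r. g (h r)) integrable_on {0..b}" for b
  proof (rule integrable_step_path[OF mono])
    show "\<bar>g i\<bar> \<le> max \<bar>g 0\<bar> \<bar>g 1\<bar>" for i by (subst g01) simp
  qed simp
  have hmono: "h r \<le> h s" if "0 \<le> r" "r \<le> s" for r s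
    using mono that by (auto simp: mono_on_def)
  have "(\<forall>r\<in>{s..t}. ?P r < \<beta>) \<longleftrightarrow> below t \<beta> (g i) (g (Suc i)) (?P s) s (map ?\<tau> [i..<h t])"
    if "i \<le> h t" "0 \<le> s" "s \<le> t" "\<And>r. s \<le> r \<Longrightarrow> i \<le> h r" "\<And>r. 0 \<le> r \<Longrightarrow> r < s \<Longrightarrow> h r \<le> i" for i s
    using that
  proof (induction "h t - i" arbitrary: i s)
    case 0
    then have i: "i = h t" by simp
    have lin: "?P r = ?P s + g i * (r - s)" if r: "r \<in> {s..t}" for r
    proof (rule integral_step_path_linear[OF int])
      show "h q = i" if "s \<le> q" "q < r" for q
        using hmono[of q t] "0.prems"(2) "0.prems"(4)[OF that(1)] that r i by simp
    qed (use r "0.prems" in auto)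
    have "(\<forall>r\<in>{s..t}. ?P r < \<beta>) \<longleftrightarrow> (\<forall>r\<in>{s..t}. ?P s + g i * (r - s) < \<beta>)"
      by (rule ball_cong[OF refl], subst lin, assumption, rule refl)
    also have "\<dots> \<longleftrightarrow> ?P s < \<beta> \<and> ?P s + g i * (t - s) < \<beta>"
      by (rule affine_below_iff[OF "0.prems"(3)])
    finally show ?case using i by simp
  next
    case (Suc m)
    let ?y = "?\<tau> i"
    have i: "i < h t" "m = h t - Suc i" using Suc.hyps(2) by auto
    have \<tau>: "?y \<le> c \<longleftrightarrow> i < h c" if "0 \<le> c" "c \<le> t" for c
      using that i by (intro jump_time_le_iff' mono cont) auto
    have y: "0 \<le> ?y" "?y \<le> t" using jump_time_bounds[OF t] by auto
    have sy: "s \<le> ?y"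
    proof (rule ccontr)
      assume "\<not> s \<le> ?y"
      then show False using Suc.prems(5)[OF y(1)] \<tau>[OF y] by simp
    qed
    have hi: "h r = i" if "s \<le> r" "r < ?y" for r
      using that \<tau>[of r] Suc.prems(2,4) y by (intro antisym) auto
    have lin: "?P r = ?P s + g i * (r - s)" if "r \<in> {s..?y}" for r
      using that Suc.prems(2) hi by (intro integral_step_path_linear int) auto
    have "{s..t} = {s..?y} \<union> {?y..t}" using sy y by auto
    then have "(\<forall>r\<in>{s..t}. ?P r < \<beta>) \<longleftrightarrow> (\<forall>r\<in>{s..?y}. ?P r < \<beta>) \<and> (\<forall>r\<in>{?y..t}. ?P r < \<beta>)"
      by blast
    also have "(\<forall>r\<in>{s..?y}. ?P r < \<beta>) \<longleftrightarrow> (\<forall>r\<in>{s..?y}. ?P s + g i * (r - s) < \<beta>)"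
      by (rule ball_cong[OF refl], subst lin, assumption, rule refl)
    also have "\<dots> \<longleftrightarrow> ?P s < \<beta> \<and> ?P ?y < \<beta>"
      using lin[of ?y] affine_below_iff[OF sy, of "?P s" "g i" \<beta>] sy by simp
    also have "(?P s < \<beta> \<and> ?P ?y < \<beta>) \<and> (\<forall>r\<in>{?y..t}. ?P r < \<beta>) \<longleftrightarrow> ?P s < \<beta> \<and> (\<forall>r\<in>{?y..t}. ?P r < \<beta>)"
      using y by auto
    also have "(\<forall>r\<in>{?y..t}. ?P r < \<beta>)
        \<longleftrightarrow> below t \<beta> (g (Suc i)) (g (Suc (Suc i))) (?P ?y) ?y (map ?\<tau> [Suc i..<h t])"
    proof (rule Suc.hyps(1)[OF i(2)])
      show "Suc i \<le> h r" if "?y \<le> r" for r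
        using \<tau>[OF y] hmono[OF y(1) that] by simp
      show "h r \<le> Suc i" if "0 \<le> r" "r < ?y" for r
        using \<tau>[of r] that y by auto
    qed (use i y in auto)
    also have "?P s < \<beta> \<and> \<dots> \<longleftrightarrow> below t \<beta> (g i) (g (Suc i)) (?P s) s (map ?\<tau> [i..<h t])"
      using i(1) lin[of ?y] sy by (simp add: upt_conv_Cons g)
    finally show ?case .
  qed
  from this[of 0 0] show ?thesis using t h0 by simp
qed

lemma SUP_less_iff_continuous:
  fixes f :: "real \<Rightarrow> real"
  assumes "continuous_on {0..t} f" "0 \<le> t"
  shows "(SUP s\<in>{0..t}. f s) < \<beta> \<longleftrightarrow> (\<forall>s\<in>{0..t}. f s < \<beta>)"
proof
  assume "(SUP s\<in>{0..t}. f s) < \<beta>"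
  moreover have "bdd_above (f ` {0..t})"
    using assms(1) by (intro bounded_imp_bdd_above compact_imp_bounded compact_continuous_image) auto
  ultimately show "\<forall>s\<in>{0..t}. f s < \<beta>" by (meson cSUP_upper le_less_trans)
next
  assume *: "\<forall>s\<in>{0..t}. f s < \<beta>"
  obtain x where x: "x \<in> {0..t}" "\<forall>s\<in>{0..t}. f s \<le> f x"
    using continuous_attains_sup[of "{0..t}" f] assms by auto
  then have "(SUP s\<in>{0..t}. f s) \<le> f x" using assms(2) by (intro cSUP_least) auto
  with * x(1) show "(SUP s\<in>{0..t}. f s) < \<beta>" by force
qed

text \<open>The position is continuous in time, so its supremum over \<open>{0..t}\<close> is attained and the strict
  inequality may be checked pointwise.\<close>

lemma sup_position_below_iff:
  assumes path: "mono_on {0..} (\<lambda>r. N r \<omega>)" "\<And>r. 0 \<le> r \<Longrightarrow> continuous (at_right r) (\<lambda>r. N r \<omega>)" "N 0 \<omega> = 0"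
    and "0 \<le> t" "c1 \<noteq> - c2" "V0 \<omega> = c1"
  shows "(SUP s\<in>{0..t}. telegraph_position c1 c2 V0 N s \<omega>) < \<beta>
    \<longleftrightarrow> below t \<beta> c1 (- c2) 0 0 (map (jump_time (\<lambda>r. N r \<omega>) t) [0..<N t \<omega>])"
proof -
  define g where "g = (\<lambda>i::nat. if even i then c1 else - c2)"
  have "(switch_velocity c1 c2 ^^ i) c1 = g i" for i
    using assms(5) by (induction i) (auto simp: switch_velocity_def g_def)
  then have pos: "telegraph_position c1 c2 V0 N = (\<lambda>s \<omega>'. integral {0..s} (\<lambda>r. telegraph_velocity c1 c2 V0 N r \<omega>'))"
    and vel: "telegraph_velocity c1 c2 V0 N r \<omega> = g (N r \<omega>)" for r
    using assms(6) by (auto simp: telegraph_position_def telegraph_velocity_def fun_eq_iff)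
  have "(\<lambda>r. g (N r \<omega>)) integrable_on {0..t}"
    by (rule integrable_step_path[OF path(1), where C = "max \<bar>c1\<bar> \<bar>c2\<bar>"]) (auto simp: g_def)
  then have "continuous_on {0..t} (\<lambda>s. integral {0..s} (\<lambda>r. g (N r \<omega>)))"
    by (rule indefinite_integral_continuous_1)
  then show ?thesis
    using path_below_iff[of "\<lambda>r. N r \<omega>" t g \<beta>] path assms(4)
    unfolding pos vel by (subst SUP_less_iff_continuous) (auto simp: g_def)
qed

section \<open>Conditional distribution of the maximum\<close>

text \<open>At time \<open>0\<close> and level \<open>0\<close> the coordinates are \<open>u = c1 * t - \<beta>\<close> and \<open>v = c2 * t + \<beta>\<close>.\<close>

lemma prob_below_polynomial:
  assumes "poisson_process M lam N" and c: "0 < c1" "0 < c2" and t: "0 < t" and \<beta>: "\<beta> \<in> {0..c1 * t}"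
  shows "measure M {\<omega> \<in> space M. N t \<omega> = 2 * k
      \<and> below t \<beta> c1 (- c2) 0 0 (map (jump_time (\<lambda>s. N s \<omega>) t) [0..<2 * k])}
    = lam ^ (2 * k) * exp (- (lam * t))
      * (up_poly (c2 / c1) k (c1 * t - \<beta>) (c2 * t + \<beta>) / (fact (2 * k) * (c1 + c2) ^ (2 * k)))"
proof -
  interpret poisson_process M lam N by fact
  let ?n = "2 * k"
  let ?P = "PiM {0..<?n} (\<lambda>_. lborel :: real measure)"
  let ?Q = "\<lambda>f. below t \<beta> c1 (- c2) 0 0 (map f [0..<?n])"
  let ?u = "c1 * t - \<beta>" and ?v = "c2 * t + \<beta>"
  have Q: "Measurable.pred ?P ?Q"
    using measurable_below[of "\<lambda>_. 0" ?P "\<lambda>_. 0" "[0..<?n]" "\<lambda>i f. f i"] by simp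
  have restrict: "map (\<lambda>i\<in>{0..<?n}. h i) [0..<?n] = map h [0..<?n]" for h :: "nat \<Rightarrow> real" by simp
  have "prob {\<omega> \<in> space M. N t \<omega> = ?n \<and> ?Q (jump_time (\<lambda>s. N s \<omega>) t)}
      = lam ^ ?n * exp (- (lam * t)) * measure ?P {f \<in> switch_simplex t ?n. ?Q f}"
    using prob_jump_times[OF less_imp_le[OF t] Q] by (simp only: restrict)
  also have "{f \<in> switch_simplex t ?n. ?Q f} = switch_times_below t \<beta> c1 (- c2) 0 0 0 ?n"
    by (auto simp: switch_simplex_def switch_times_below_def)
  also have "measure ?P \<dots> = up_poly (c2 / c1) k ?u ?v / (fact ?n * (c1 + c2) ^ ?n)"
  proof -
    have "c2 / c1 * ?u \<le> ?v"
    proof -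
      have "c2 / c1 * ?u = c2 * t - c2 / c1 * \<beta>" using c by (simp add: field_simps)
      moreover have "0 \<le> c2 / c1 * \<beta>" using c \<beta> by simp
      ultimately show ?thesis using \<beta> by simp
    qed
    then have "0 \<le> up_poly (c2 / c1) k ?u ?v" using c \<beta> by (intro up_poly_nonneg) auto
    then show ?thesis
      using volume_below_up_down(1)[OF c, of ?n 0 k 0 t 0 \<beta>] c t \<beta>
      by (simp add: volume_below_def measure_def)
  qed
  finally show ?thesis .
qed

theorem theorem2p1:
  fixes M :: "'a measure" and N :: "real \<Rightarrow> 'a \<Rightarrow> nat" and V0 :: "'a \<Rightarrow> real"
    and lam c1 c2 t \<beta> :: real and k :: nat
  assumes "asymmetric_telegraph M lam N c1 c2 V0"
    and "t > 0" and "k \<ge> 1" and "\<beta> \<in> {0..c1 * t}"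
  shows "\<P>(\<omega> in M. (SUP s\<in>{0..t}. telegraph_position c1 c2 V0 N s \<omega>) < \<beta>
            \<bar> telegraph_velocity c1 c2 V0 N 0 \<omega> = c1 \<and> N t \<omega> = 2 * k)
       = 1 / ((c1 + c2) * t) ^ (2 * k) *
         (\<Sum>j = 0..k - 1. real ((2 * k) choose j) *
            ((c1 * t - \<beta>) ^ j * (c2 * t + \<beta>) ^ (2 * k - j)
             - (c2 / c1) ^ (2 * k - 2 * j) * (c1 * t - \<beta>) ^ (2 * k - j) * (c2 * t + \<beta>) ^ j))"
proof -
  interpret asymmetric_telegraph M lam N c1 c2 V0 by fact
  let ?n = "2 * k" and ?p = "up_poly (c2 / c1) k (c1 * t - \<beta>) (c2 * t + \<beta>)"
  let ?sup = "\<lambda>\<omega>. SUP s\<in>{0..t}. telegraph_position c1 c2 V0 N s \<omega>"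
  let ?Q = "\<lambda>\<omega>. below t \<beta> c1 (- c2) 0 0 (map (jump_time (\<lambda>s. N s \<omega>) t) [0..<?n])"
  let ?SV = "vimage_algebra (space M) V0 borel"
  let ?PN = "PiM {0..} (\<lambda>_::real. count_space (UNIV :: nat set))"
  let ?path = "\<lambda>\<omega>. \<lambda>s\<in>{0..}. N s \<omega>"
  let ?SN = "vimage_algebra (space M) ?path ?PN"
  have path: "?path \<in> measurable ?SN ?PN"
    by (rule measurable_vimage_algebra1) (auto simp: space_PiM)
  have N_meas: "N s \<in> measurable ?SN (count_space UNIV)" if "0 \<le> s" for s
  proof -
    have "(\<lambda>\<omega>. ?path \<omega> s) \<in> measurable ?SN (count_space UNIV)"
      using that by (intro measurable_compose[OF path measurable_component_singleton]) auto
    then show ?thesis using that by simp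
  qed
  have up: "{\<omega> \<in> space M. V0 \<omega> = c1} \<in> sets ?SV"
    using in_vimage_algebra[of "{c1}" borel V0 "space M"] by (simp add: vimage_def Int_def conj_commute)
  have half: "prob ({\<omega> \<in> space M. V0 \<omega> = c1} \<inter> A) = 1 / 2 * prob A" if "A \<in> sets ?SN" for A
    using indep_setD[OF indep_V0_N up that] prob_V0_c1 by simp
  have count: "{\<omega> \<in> space M. N t \<omega> = ?n} \<in> sets ?SN"
    using measurable_sets[OF N_meas[of t], of "{?n}"] assms(2)
    by (simp add: vimage_def Int_def conj_commute)
  have "Measurable.pred ?SN ?Q"
    using assms(2) N_meas
    by (intro measurable_below[where g = "\<lambda>i \<omega>. jump_time (\<lambda>s. N s \<omega>) t i"] jump_time_measurable) auto
  with count have below: "{\<omega> \<in> space M. N t \<omega> = ?n \<and> ?Q \<omega>} \<in> sets ?SN"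
    using sets.Int[OF count, of "{\<omega> \<in> space M. ?Q \<omega>}"] by (simp add: pred_def Int_def conj_ac)
  have vel0: "telegraph_velocity c1 c2 V0 N 0 \<omega> = V0 \<omega>" if "\<omega> \<in> space M" for \<omega>
    using N_0[OF that] by (simp add: telegraph_velocity_def)
  have sup: "?sup \<omega> < \<beta> \<longleftrightarrow> ?Q \<omega>" if "\<omega> \<in> space M" "V0 \<omega> = c1" "N t \<omega> = ?n" for \<omega>
    using sup_position_below_iff[of N \<omega> t c1 c2 V0 \<beta>] that mono_N right_continuous_N N_0
      assms(2) c1_pos c2_pos by simp
  have "{\<omega> \<in> space M. ?sup \<omega> < \<beta> \<and> telegraph_velocity c1 c2 V0 N 0 \<omega> = c1 \<and> N t \<omega> = ?n}
      = {\<omega> \<in> space M. V0 \<omega> = c1} \<inter> {\<omega> \<in> space M. N t \<omega> = ?n \<and> ?Q \<omega>}"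
    using sup vel0 by auto
  then have num: "prob {\<omega> \<in> space M. ?sup \<omega> < \<beta> \<and> telegraph_velocity c1 c2 V0 N 0 \<omega> = c1 \<and> N t \<omega> = ?n}
      = 1 / 2 * (lam ^ ?n * exp (- (lam * t)) * (?p / (fact ?n * (c1 + c2) ^ ?n)))"
    using half[OF below] prob_below_polynomial[OF poisson_process_axioms c1_pos c2_pos assms(2,4), of k]
    by simp
  have "{\<omega> \<in> space M. telegraph_velocity c1 c2 V0 N 0 \<omega> = c1 \<and> N t \<omega> = ?n}
      = {\<omega> \<in> space M. V0 \<omega> = c1} \<inter> {\<omega> \<in> space M. N t \<omega> = ?n}"
    using vel0 by auto
  then have den: "prob {\<omega> \<in> space M. telegraph_velocity c1 c2 V0 N 0 \<omega> = c1 \<and> N t \<omega> = ?n}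
      = 1 / 2 * ((lam * t) ^ ?n / fact ?n * exp (- (lam * t)))"
    using half[OF count] prob_count_eq[of t ?n] assms(2) by simp
  have "\<P>(\<omega> in M. ?sup \<omega> < \<beta> \<bar> telegraph_velocity c1 c2 V0 N 0 \<omega> = c1 \<and> N t \<omega> = ?n)
      = 1 / ((c1 + c2) * t) ^ ?n * ?p"
    unfolding cond_prob_def num den power_mult_distrib using rate_pos assms(2) c1_pos c2_pos by simp
  moreover have "{0..k - 1} = {..<k}" using assms(3) by auto
  ultimately show ?thesis by (simp add: up_poly_def)
qed

end
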